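(* The satisfiability problem for $\mathrm{F}_1[\mathrm{succ},\sim]$ (one-dimensional formulas over unary predicates, the successor relation and the data equivalence relation $\sim$, without the order $<$) over finite data words is undecidable, and so is the satisfiability problem over $\omega$-data-words.
   Context: A word is a finite structure over $\sigma_0\cup\{\mathrm{succ},<\}$, $\sigma_0$ a finite set of unary relation symbols, $<$ a strict linear order and $\mathrm{succ}$ its induced successor; an $\omega$-word is an infinite such structure whose $\{\mathrm{succ},<\}$-reduct is isomorphic to $(\mathbb N,+1,<)$. A data word ($\omega$-data-word) is a word ($\omega$-word) expanded with an additional binary relation $\sim$ interpreted as an (arbitrary) equivalence relation. $\mathrm{F}_1$ (one-dimensional fragment) is the smallest set of first-order formulas containing atoms and equalities, closed under $\vee,\neg$, and such that if $\varphi$ has free variables among $x_0,\dots,x_k$ then $\exists x_0\dots x_k\varphi$ and $\exists x_1\dots x_k\varphi$ are in it. *)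

theory Defs
  imports Main "HOL-Library.Nat_Bijection"
begin

section \<open>First-order formulas and the one-dimensional fragment\<close>

datatype binsym = Succ | Less | Sim

text \<open>Variables and unary relation symbols are indexed by natural numbers.\<close>

datatype fo =
    Unary nat nat
  | Binary binsym nat nat
  | Equal nat nat
  | Neg fo
  | Or fo fo
  | Exists nat fo

primrec fv :: "fo \<Rightarrow> nat set" where
  "fv (Unary p x) = {x}"
| "fv (Binary b x y) = {x, y}"
| "fv (Equal x y) = {x, y}"
| "fv (Neg \<phi>) = fv \<phi>"
| "fv (Or \<phi> \<psi>) = fv \<phi> \<union> fv \<psi>"
| "fv (Exists x \<phi>) = fv \<phi> - {x}"

primrec unary_syms :: "fo \<Rightarrow> nat set" where
  "unary_syms (Unary p x) = {p}"
| "unary_syms (Binary b x y) = {}"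
| "unary_syms (Equal x y) = {}"
| "unary_syms (Neg \<phi>) = unary_syms \<phi>"
| "unary_syms (Or \<phi> \<psi>) = unary_syms \<phi> \<union> unary_syms \<psi>"
| "unary_syms (Exists x \<phi>) = unary_syms \<phi>"

definition Exs :: "nat list \<Rightarrow> fo \<Rightarrow> fo" where
  "Exs xs \<phi> = foldr Exists xs \<phi>"

text \<open>
  \<open>F1 B\<close> is the one-dimensional fragment in which the binary relation symbols are taken
  from \<open>B\<close>. In the two quantifier rules \<open>x0 # xs\<close> is the tuple \<open>x\<^sub>0, \<dots>, x\<^sub>k\<close> of arbitrary
  pairwise distinct variables.
\<close>

inductive_set F1 :: "binsym set \<Rightarrow> fo set" for B :: "binsym set" where
  unary: "Unary p x \<in> F1 B"
| binary: "b \<in> B \<Longrightarrow> Binary b x y \<in> F1 B"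
| equal: "Equal x y \<in> F1 B"
| neg: "\<phi> \<in> F1 B \<Longrightarrow> Neg \<phi> \<in> F1 B"
| disj: "\<phi> \<in> F1 B \<Longrightarrow> \<psi> \<in> F1 B \<Longrightarrow> Or \<phi> \<psi> \<in> F1 B"
| ex_all: "\<phi> \<in> F1 B \<Longrightarrow> distinct (x0 # xs) \<Longrightarrow> fv \<phi> \<subseteq> set (x0 # xs) \<Longrightarrow> Exs (x0 # xs) \<phi> \<in> F1 B"
| ex_but_one: "\<phi> \<in> F1 B \<Longrightarrow> distinct (x0 # xs) \<Longrightarrow> fv \<phi> \<subseteq> set (x0 # xs) \<Longrightarrow> Exs xs \<phi> \<in> F1 B"

definition sentences :: "fo set \<Rightarrow> fo set" where
  "sentences F = {\<phi> \<in> F. fv \<phi> = {}}"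


section \<open>Data words\<close>

record 'a struct =
  elems :: "'a set"
  un :: "nat \<Rightarrow> 'a set"
  rel :: "binsym \<Rightarrow> ('a \<times> 'a) set"

primrec sat :: "'a struct \<Rightarrow> (nat \<Rightarrow> 'a) \<Rightarrow> fo \<Rightarrow> bool" where
  "sat M v (Unary p x) \<longleftrightarrow> v x \<in> un M p"
| "sat M v (Binary b x y) \<longleftrightarrow> (v x, v y) \<in> rel M b"
| "sat M v (Equal x y) \<longleftrightarrow> v x = v y"
| "sat M v (Neg \<phi>) \<longleftrightarrow> \<not> sat M v \<phi>"
| "sat M v (Or \<phi> \<psi>) \<longleftrightarrow> sat M v \<phi> \<or> sat M v \<psi>"
| "sat M v (Exists x \<phi>) \<longleftrightarrow> (\<exists>a \<in> elems M. sat M (v(x := a)) \<phi>)"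

definition models :: "'a struct \<Rightarrow> fo \<Rightarrow> bool" where
  "models M \<phi> \<longleftrightarrow> (\<forall>v. range v \<subseteq> elems M \<longrightarrow> sat M v \<phi>)"

text \<open>
  \<open>un M\<close> is a total function, so the restriction to the finite signature \<open>\<sigma>0\<close> is expressed by
  giving the empty interpretation to all other symbols. As usual in model theory, domains are
  nonempty.
\<close>

definition is_struct :: "nat set \<Rightarrow> 'a struct \<Rightarrow> bool" where
  "is_struct \<sigma>0 M \<longleftrightarrow> finite \<sigma>0 \<and> elems M \<noteq> {}
     \<and> (\<forall>p \<in> \<sigma>0. un M p \<subseteq> elems M) \<and> (\<forall>p. p \<notin> \<sigma>0 \<longrightarrow> un M p = {})
     \<and> (\<forall>b. rel M b \<subseteq> elems M \<times> elems M)"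

definition data_word :: "nat set \<Rightarrow> 'a struct \<Rightarrow> bool" where
  "data_word \<sigma>0 M \<longleftrightarrow> is_struct \<sigma>0 M \<and> finite (elems M)
     \<and> strict_linear_order_on (elems M) (rel M Less)
     \<and> rel M Succ = {(a, b) \<in> rel M Less. \<not> (\<exists>c. (a, c) \<in> rel M Less \<and> (c, b) \<in> rel M Less)}
     \<and> equiv (elems M) (rel M Sim)"

definition omega_data_word :: "nat set \<Rightarrow> 'a struct \<Rightarrow> bool" where
  "omega_data_word \<sigma>0 M \<longleftrightarrow> is_struct \<sigma>0 M
     \<and> (\<exists>h :: nat \<Rightarrow> 'a. bij_betw h UNIV (elems M)
          \<and> (\<forall>i j. (h i, h j) \<in> rel M Less \<longleftrightarrow> i < j)
          \<and> (\<forall>i j. (h i, h j) \<in> rel M Succ \<longleftrightarrow> j = i + 1))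
     \<and> equiv (elems M) (rel M Sim)"

text \<open>
  All data words are countable, so restricting to structures whose elements are natural numbers
  is no loss; see \<open>fin_satisfiableI\<close> and \<open>omega_satisfiableI\<close> below.
\<close>

definition fin_satisfiable :: "fo \<Rightarrow> bool" where
  "fin_satisfiable \<phi> \<longleftrightarrow>
     (\<exists>\<sigma>0 (M :: nat struct). unary_syms \<phi> \<subseteq> \<sigma>0 \<and> data_word \<sigma>0 M \<and> models M \<phi>)"

definition omega_satisfiable :: "fo \<Rightarrow> bool" where
  "omega_satisfiable \<phi> \<longleftrightarrow>
     (\<exists>\<sigma>0 (M :: nat struct). unary_syms \<phi> \<subseteq> \<sigma>0 \<and> omega_data_word \<sigma>0 M \<and> models M \<phi>)"

definition map_struct :: "('a \<Rightarrow> 'b) \<Rightarrow> 'a struct \<Rightarrow> 'b struct" where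
  "map_struct f M =
     \<lparr>elems = f ` elems M, un = (\<lambda>p. f ` un M p), rel = (\<lambda>b. map_prod f f ` rel M b)\<rparr>"

lemma map_struct_simps [simp]:
  "elems (map_struct f M) = f ` elems M"
  "un (map_struct f M) p = f ` un M p"
  "rel (map_struct f M) b = map_prod f f ` rel M b"
  by (simp_all add: map_struct_def)

lemma is_struct_subset:
  assumes "is_struct \<sigma>0 M" shows "un M p \<subseteq> elems M" "rel M b \<subseteq> elems M \<times> elems M"
proof -
  show "un M p \<subseteq> elems M"
    using assms by (cases "p \<in> \<sigma>0") (simp_all add: is_struct_def)
  show "rel M b \<subseteq> elems M \<times> elems M"
    using assms by (simp add: is_struct_def)
qed

lemma is_struct_map:
  assumes "is_struct \<sigma>0 M" shows "is_struct \<sigma>0 (map_struct f M)"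
proof -
  have "map_prod f f ` rel M b \<subseteq> f ` elems M \<times> f ` elems M" for b
    using is_struct_subset(2)[OF assms, of b] by auto
  moreover have "f ` un M p \<subseteq> f ` elems M" for p
    using is_struct_subset(1)[OF assms, of p] by (rule image_mono)
  ultimately show ?thesis
    using assms unfolding is_struct_def map_struct_simps by simp
qed

lemma map_rel_iff:
  assumes f: "inj_on f A" and r: "r \<subseteq> A \<times> A" and "a \<in> A" "b \<in> A"
  shows "(f a, f b) \<in> map_prod f f ` r \<longleftrightarrow> (a, b) \<in> r"
proof
  assume "(f a, f b) \<in> map_prod f f ` r"
  then obtain c d where cd: "(c, d) \<in> r" "f a = f c" "f b = f d" by auto
  then have "c \<in> A" "d \<in> A" using r by auto
  then have "a = c" "b = d" using cd assms by (auto dest: inj_onD)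
  then show "(a, b) \<in> r" using cd by simp
next
  assume "(a, b) \<in> r"
  then show "(f a, f b) \<in> map_prod f f ` r" by force
qed

lemma sat_map:
  assumes f: "inj_on f (elems M)" and M: "is_struct \<sigma>0 M"
  shows "range v \<subseteq> elems M \<Longrightarrow> sat (map_struct f M) (f \<circ> v) \<phi> \<longleftrightarrow> sat M v \<phi>"
proof (induction \<phi> arbitrary: v)
  case (Unary p x)
  have "v x \<in> elems M" using Unary by auto
  then show ?case using inj_on_image_mem_iff[OF f _ is_struct_subset(1)[OF M]] by auto
next
  case (Binary b x y)
  have "v x \<in> elems M" "v y \<in> elems M" using Binary by auto
  then show ?case using map_rel_iff[OF f is_struct_subset(2)[OF M]] by auto
next
  case (Equal x y)
  have "v x \<in> elems M" "v y \<in> elems M" using Equal by auto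
  then show ?case using f by (simp add: inj_on_eq_iff)
next
  case (Exists x \<phi>)
  have "sat (map_struct f M) ((f \<circ> v)(x := f a)) \<phi> \<longleftrightarrow> sat M (v(x := a)) \<phi>" if "a \<in> elems M" for a
  proof -
    have "range (v(x := a)) \<subseteq> elems M" using that Exists.prems by auto
    from Exists.IH[OF this] show ?thesis by (simp only: fun_upd_comp)
  qed
  then show ?case by (simp del: fun_upd_apply add: comp_def)
qed auto

lemma models_map:
  fixes f :: "'a \<Rightarrow> 'b"
  assumes f: "inj_on f (elems M)" and M: "is_struct \<sigma>0 M" and "models M \<phi>"
  shows "models (map_struct f M) \<phi>"
  unfolding models_def
proof (intro allI impI)
  fix w :: "nat \<Rightarrow> 'b" assume w: "range w \<subseteq> elems (map_struct f M)"
  define v where "v = inv_into (elems M) f \<circ> w"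
  have v: "range v \<subseteq> elems M"
    using w by (auto simp: v_def intro!: inv_into_into)
  have "w = f \<circ> v"
    using w by (auto simp: v_def fun_eq_iff f_inv_into_f image_subset_iff)
  with sat_map[OF f M v] v \<open>models M \<phi>\<close> show "sat (map_struct f M) w \<phi>"
    by (simp add: models_def)
qed

lemma equiv_map:
  assumes f: "inj_on f A" and r: "equiv A r"
  shows "equiv (f ` A) (map_prod f f ` r)"
proof -
  have sub: "r \<subseteq> A \<times> A" using r by (auto simp: equiv_def refl_on_def)
  show ?thesis
  proof (rule equivI)
    show "map_prod f f ` r \<subseteq> f ` A \<times> f ` A" using sub by auto
    show "refl_on (f ` A) (map_prod f f ` r)"
      using r by (auto simp: equiv_def refl_on_def)
    show "sym (map_prod f f ` r)"
    proof (rule symI)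
      fix x y assume "(x, y) \<in> map_prod f f ` r"
      then obtain a b where "(a, b) \<in> r" "x = f a" "y = f b" by auto
      moreover from this r have "(b, a) \<in> r" by (auto simp: equiv_def dest: symD)
      ultimately show "(y, x) \<in> map_prod f f ` r" by force
    qed
    show "trans (map_prod f f ` r)"
    proof (rule transI)
      fix x y z assume "(x, y) \<in> map_prod f f ` r" "(y, z) \<in> map_prod f f ` r"
      then obtain a b b' c where *: "(a, b) \<in> r" "(b', c) \<in> r" "x = f a" "y = f b" "y = f b'" "z = f c"
        by auto
      then have "b = b'" using f sub by (auto simp: inj_on_def)
      with * r have "(a, c) \<in> r" by (auto simp: equiv_def dest: transD)
      with * show "(x, z) \<in> map_prod f f ` r" by force
    qed
  qed
qed

lemma data_word_map:
  assumes f: "inj_on f (elems M)" and M: "data_word \<sigma>0 M"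
  shows "data_word \<sigma>0 (map_struct f M)"
proof -
  let ?L = "rel M Less" and ?A = "f ` elems M"
  define R where "R b = map_prod f f ` rel M b" for b
  have s: "is_struct \<sigma>0 M" using M by (simp add: data_word_def)
  note sub = is_struct_subset(2)[OF s]
  have iff: "(f a, f b) \<in> R c \<longleftrightarrow> (a, b) \<in> rel M c" if "a \<in> elems M" "b \<in> elems M" for a b c
    unfolding R_def by (rule map_rel_iff[OF f sub that])
  have Rsub: "R c \<subseteq> ?A \<times> ?A" for c
    using sub[of c] by (auto simp: R_def)
  have lin: "trans ?L" "irrefl ?L" "total_on (elems M) ?L"
    using M by (auto simp: data_word_def strict_linear_order_on_def)
  have "trans (R Less)"
  proof (rule transI)
    fix x y z assume *: "(x, y) \<in> R Less" "(y, z) \<in> R Less"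
    then obtain a b c where abc: "x = f a" "y = f b" "z = f c" "a \<in> elems M" "b \<in> elems M" "c \<in> elems M"
      using Rsub[of Less] by blast
    then have "(a, b) \<in> ?L" "(b, c) \<in> ?L" using * iff by blast+
    with lin(1) have "(a, c) \<in> ?L" by (rule transD)
    then show "(x, z) \<in> R Less" using abc iff by blast
  qed
  moreover have "irrefl (R Less)"
  proof (rule irreflI)
    fix x show "(x, x) \<notin> R Less"
    proof
      assume *: "(x, x) \<in> R Less"
      then obtain a where "x = f a" "a \<in> elems M" using Rsub[of Less] by blast
      then show False using * lin(2) iff by (auto simp: irrefl_def)
    qed
  qed
  moreover have "total_on ?A (R Less)"
    using lin(3) iff unfolding total_on_def by auto
  moreover have "R Succ = {(a, b) \<in> R Less. \<not> (\<exists>c. (a, c) \<in> R Less \<and> (c, b) \<in> R Less)}" (is "_ = ?r")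
  proof -
    have S: "rel M Succ = {(a, b) \<in> ?L. \<not> (\<exists>c. (a, c) \<in> ?L \<and> (c, b) \<in> ?L)}"
      using M by (simp add: data_word_def)
    have ex: "(\<exists>z. (f a, z) \<in> R Less \<and> (z, f b) \<in> R Less) \<longleftrightarrow> (\<exists>c. (a, c) \<in> ?L \<and> (c, b) \<in> ?L)"
      if ab: "a \<in> elems M" "b \<in> elems M" for a b
    proof
      assume "\<exists>z. (f a, z) \<in> R Less \<and> (z, f b) \<in> R Less"
      then obtain z where z: "(f a, z) \<in> R Less" "(z, f b) \<in> R Less" by blast
      then obtain c where "z = f c" "c \<in> elems M" using Rsub[of Less] by blast
      then show "\<exists>c. (a, c) \<in> ?L \<and> (c, b) \<in> ?L" using z iff ab by blast
    next
      assume "\<exists>c. (a, c) \<in> ?L \<and> (c, b) \<in> ?L"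
      then obtain c where c: "(a, c) \<in> ?L" "(c, b) \<in> ?L" by blast
      then have "c \<in> elems M" using sub by blast
      then show "\<exists>z. (f a, z) \<in> R Less \<and> (z, f b) \<in> R Less" using c iff ab by blast
    qed
    have r: "(f a, f b) \<in> R Succ \<longleftrightarrow> (f a, f b) \<in> ?r" if ab: "a \<in> elems M" "b \<in> elems M" for a b
      using S by (simp only: ex[OF ab] iff[OF ab] mem_Collect_eq prod.case)
    show ?thesis
    proof (rule set_eqI)
      fix p show "p \<in> R Succ \<longleftrightarrow> p \<in> ?r"
      proof (cases "p \<in> ?A \<times> ?A")
        case True
        then obtain a b where "p = (f a, f b)" "a \<in> elems M" "b \<in> elems M" by blast
        then show ?thesis using r by simp
      next
        case False
        then show ?thesis using Rsub[of Succ] Rsub[of Less] by auto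
      qed
    qed
  qed
  moreover have "equiv ?A (R Sim)"
    using equiv_map[OF f] M by (simp add: data_word_def R_def)
  moreover have "finite ?A"
    using M by (simp add: data_word_def)
  ultimately show ?thesis
    unfolding data_word_def strict_linear_order_on_def map_struct_simps R_def[symmetric]
    using is_struct_map[OF s] by blast
qed

lemma omega_data_word_map:
  assumes f: "inj_on f (elems M)" and M: "omega_data_word \<sigma>0 M"
  shows "omega_data_word \<sigma>0 (map_struct f M)"
proof -
  have s: "is_struct \<sigma>0 M" using M by (simp add: omega_data_word_def)
  note iff = map_rel_iff[OF f is_struct_subset(2)[OF s]]
  obtain h :: "nat \<Rightarrow> 'a" where h: "bij_betw h UNIV (elems M)"
      "\<And>i j. (h i, h j) \<in> rel M Less \<longleftrightarrow> i < j" "\<And>i j. (h i, h j) \<in> rel M Succ \<longleftrightarrow> j = i + 1"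
    using M by (auto simp: omega_data_word_def)
  have hd: "h i \<in> elems M" for i using h(1) by (auto simp: bij_betw_def)
  have "bij_betw (f \<circ> h) UNIV (f ` elems M)"
    using bij_betw_trans[OF h(1) inj_on_imp_bij_betw[OF f]] .
  moreover have "equiv (f ` elems M) (map_prod f f ` rel M Sim)"
    using equiv_map[OF f] M by (simp add: omega_data_word_def)
  ultimately show ?thesis
    unfolding omega_data_word_def using is_struct_map[OF s] iff[OF hd hd] h(2,3)
    by (intro conjI exI[of _ "f \<circ> h"]) simp_all
qed

lemma fin_satisfiableI:
  fixes M :: "'a struct"
  assumes "unary_syms \<phi> \<subseteq> \<sigma>0" "data_word \<sigma>0 M" "models M \<phi>"
  shows "fin_satisfiable \<phi>"
proof -
  have "finite (elems M)" using assms(2) by (simp add: data_word_def)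
  then obtain f :: "'a \<Rightarrow> nat" where f: "inj_on f (elems M)"
    using finite_imp_inj_to_nat_seg by blast
  have "is_struct \<sigma>0 M" using assms(2) by (simp add: data_word_def)
  then show ?thesis
    using assms data_word_map[OF f] models_map[OF f] unfolding fin_satisfiable_def by blast
qed

lemma omega_satisfiableI:
  fixes M :: "'a struct"
  assumes "unary_syms \<phi> \<subseteq> \<sigma>0" "omega_data_word \<sigma>0 M" "models M \<phi>"
  shows "omega_satisfiable \<phi>"
proof -
  obtain h :: "nat \<Rightarrow> 'a" where "bij_betw h UNIV (elems M)"
    using assms(2) by (auto simp: omega_data_word_def)
  then have f: "inj_on (inv_into UNIV h) (elems M)"
    using bij_betw_inv_into bij_betw_imp_inj_on by blast
  have "is_struct \<sigma>0 M" using assms(2) by (simp add: omega_data_word_def)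
  then show ?thesis
    using assms omega_data_word_map[OF f] models_map[OF f] unfolding omega_satisfiable_def by blast
qed


section \<open>Decidability\<close>

text \<open>
  Algorithms are given by Kleene's \<open>\<mu>\<close>-recursive function terms; \<open>evaluates p xs y\<close> means that
  the partial function denoted by \<open>p\<close> is defined on the arguments \<open>xs\<close> with value \<open>y\<close>. A term
  applied to a tuple of the wrong length may be undefined.
\<close>

datatype recf =
    Zero
  | Succr
  | Proj nat
  | Comp recf "recf list"
  | PrimRec recf recf
  | Mu recf

inductive evaluates :: "recf \<Rightarrow> nat list \<Rightarrow> nat \<Rightarrow> bool" where
  "evaluates Zero xs 0"
| "evaluates Succr [x] (Suc x)"
| "i < length xs \<Longrightarrow> evaluates (Proj i) xs (xs ! i)"
| "list_all2 (\<lambda>g y. evaluates g xs y) gs ys \<Longrightarrow> evaluates f ys z \<Longrightarrow> evaluates (Comp f gs) xs z"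
| "evaluates f xs y \<Longrightarrow> evaluates (PrimRec f g) (0 # xs) y"
| "evaluates (PrimRec f g) (n # xs) y \<Longrightarrow> evaluates g (n # y # xs) z
     \<Longrightarrow> evaluates (PrimRec f g) (Suc n # xs) z"
| "evaluates f (n # xs) 0 \<Longrightarrow> (\<forall>m < n. \<exists>y. evaluates f (m # xs) (Suc y))
     \<Longrightarrow> evaluates (Mu f) xs n"

lemma evaluates_deterministic:
  "evaluates p xs y \<Longrightarrow> evaluates p xs z \<Longrightarrow> y = z"
proof (induction p xs y arbitrary: z rule: evaluates.induct)
  case (4 xs gs ys f y)
  from 4(4) obtain zs where zs: "list_all2 (\<lambda>g y. evaluates g xs y) gs zs" "evaluates f zs z"
    by (cases rule: evaluates.cases) auto
  have "ys = zs"
    using 4(1) zs(1) by (auto simp: list_all2_conv_all_nth intro!: nth_equalityI)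
  with zs(2) "4.IH" show ?case by blast
next
  case (6 f g n xs y w)
  from 6(5) obtain y' where "evaluates (PrimRec f g) (n # xs) y'" "evaluates g (n # y' # xs) z"
    by cases auto
  with "6.IH" show ?case by blast
next
  case (7 f n xs)
  from "7.prems" have z0: "evaluates f (z # xs) 0"
    by cases
  from "7.prems" have zm: "\<forall>m < z. \<exists>y. evaluates f (m # xs) (Suc y)"
    by cases
  show ?case
  proof (rule linorder_cases[of n z])
    assume "n < z"
    then obtain y where "evaluates f (n # xs) (Suc y)" using zm by blast
    with 7 have "0 = Suc y" by blast
    then show ?thesis by simp
  next
    assume "z < n"
    then obtain y where "\<And>w. evaluates f (z # xs) w \<Longrightarrow> Suc y = w" using 7 by blast
    with z0 have "Suc y = 0" by blast
    then show ?thesis by simp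
  qed
next
  case (1 xs)
  then show ?case by (cases rule: evaluates.cases) auto
next
  case (2 x)
  then show ?case by (cases rule: evaluates.cases) auto
next
  case (3 i xs)
  from 3(2) show ?case by (cases rule: evaluates.cases) auto
next
  case (5 f xs y g)
  from "5.prems" have "evaluates f xs z" by (cases rule: evaluates.cases) auto
  then show ?case by (rule "5.IH")
qed

text \<open>
  The decision problem with instances \<open>I\<close>, effectively encoded by \<open>code\<close>, and yes-instances
  \<open>{x \<in> I. P x}\<close>: nothing is required of the algorithm on inputs that encode no instance.
\<close>

definition decidable :: "('a \<Rightarrow> nat) \<Rightarrow> 'a set \<Rightarrow> ('a \<Rightarrow> bool) \<Rightarrow> bool" where
  "decidable code I P \<longleftrightarrow>
     (\<exists>p. \<forall>x \<in> I. evaluates p [code x] (if P x then 1 else 0))"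

primrec binsym_code :: "binsym \<Rightarrow> nat" where
  "binsym_code Succ = 0"
| "binsym_code Less = 1"
| "binsym_code Sim = 2"

primrec fo_code :: "fo \<Rightarrow> nat" where
  "fo_code (Unary p x) = prod_encode (0, prod_encode (p, x))"
| "fo_code (Binary b x y) = prod_encode (1, prod_encode (binsym_code b, prod_encode (x, y)))"
| "fo_code (Equal x y) = prod_encode (2, prod_encode (x, y))"
| "fo_code (Neg \<phi>) = prod_encode (3, fo_code \<phi>)"
| "fo_code (Or \<phi> \<psi>) = prod_encode (4, prod_encode (fo_code \<phi>, fo_code \<psi>))"
| "fo_code (Exists x \<phi>) = prod_encode (5, prod_encode (x, fo_code \<phi>))"

lemma inj_fo_code: "inj fo_code"
proof (rule injI)
  have b: "binsym_code b = binsym_code c \<Longrightarrow> b = c" for b c by (cases b; cases c) auto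
  fix \<phi> \<psi> show "fo_code \<phi> = fo_code \<psi> \<Longrightarrow> \<phi> = \<psi>"
  proof (induction \<phi> arbitrary: \<psi>)
    case (Binary b' x y)
    then show ?case by (cases \<psi>) (auto dest: b)
  next
    case (Unary p x) then show ?case by (cases \<psi>) auto
  next
    case (Equal x y) then show ?case by (cases \<psi>) auto
  next
    case (Neg \<phi>) then show ?case by (cases \<psi>) auto
  next
    case (Or \<phi>1 \<phi>2) then show ?case by (cases \<psi>) auto
  next
    case (Exists x \<phi>) then show ?case by (cases \<psi>) auto
  qed
qed

end

theory Submission imports Defs "HOL-Library.Countable" begin

text \<open>
  A data word can store any finite relational structure: a tuple is a block of consecutive
  positions whose data values name its components, and \<open>F\<^sub>1\<close> can require each stored tuple to be
  justified by other stored tuples, since such a requirement has the form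
  \<open>\<forall>x \<exists>y\<^sub>1 \<dots> y\<^sub>n. \<alpha>\<close>. Storing the triples ``\<open>f\<close> evaluates on \<open>xs\<close> to \<open>y\<close>'' for the subterms \<open>f\<close> of
  a \<open>\<mu>\<close>-recursive term, with the number \<open>n\<close> named by the \<open>n\<close>-th position of the word, makes
  the defining clauses of evaluation such requirements. Justifications are well founded because they
  descend in \<open>f\<close> or in a number, and every position has a finite index, also in \<open>\<omega>\<close>-words. So
  for each term \<open>q\<close> a sentence says that \<open>q\<close> takes the value 0 on the input, and a
  decision procedure composed with the substitution of the input is refuted by diagonalization.
\<close>

section \<open>Derived connectives\<close>

definition And :: "fo \<Rightarrow> fo \<Rightarrow> fo" where
  "And \<phi> \<psi> = Neg (Or (Neg \<phi>) (Neg \<psi>))"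

text \<open>A closed tautology, so that \<open>Conj\<close> and \<open>Disj\<close> have no free
  variables beyond those of their members.\<close>

definition Truth :: fo where
  "Truth = Neg (Exs [0] (Neg (Equal 0 0)))"

definition Conj :: "fo list \<Rightarrow> fo" where
  "Conj \<phi>s = foldr And \<phi>s Truth"

definition Disj :: "fo list \<Rightarrow> fo" where
  "Disj \<phi>s = foldr Or \<phi>s (Neg Truth)"

definition ExAll :: "fo \<Rightarrow> fo" where
  "ExAll \<phi> = Exs (sorted_list_of_set (fv \<phi>)) \<phi>"

text \<open>Variable 0 is kept as the single free variable that \<open>F1\<close> permits after a
  quantifier tuple.\<close>

definition ExBut0 :: "fo \<Rightarrow> fo" where
  "ExBut0 \<phi> = Exs (sorted_list_of_set (fv \<phi> - {0})) \<phi>"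

lemma finite_fv [simp]: "finite (fv \<phi>)"
  by (induction \<phi>) auto

lemma finite_unary_syms: "finite (unary_syms \<phi>)"
  by (induction \<phi>) auto

lemma fv_Exs [simp]: "fv (Exs xs \<phi>) = fv \<phi> - set xs"
  by (induction xs) (auto simp: Exs_def)

lemma fv_And [simp]: "fv (And \<phi> \<psi>) = fv \<phi> \<union> fv \<psi>"
  by (simp add: And_def)

lemma fv_Truth [simp]: "fv Truth = {}"
  by (simp add: Truth_def)

lemma fv_Conj [simp]: "fv (Conj \<phi>s) = (\<Union>\<phi>\<in>set \<phi>s. fv \<phi>)"
  by (induction \<phi>s) (simp_all add: Conj_def)

lemma fv_ExAll [simp]: "fv (ExAll \<phi>) = {}"
  by (simp add: ExAll_def)

section \<open>Membership of the derived connectives in \<open>F1\<close>\<close>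

lemma And_F1: "\<phi> \<in> F1 B \<Longrightarrow> \<psi> \<in> F1 B \<Longrightarrow> And \<phi> \<psi> \<in> F1 B"
  unfolding And_def by (intro F1.neg F1.disj)

lemma Truth_F1: "Truth \<in> F1 B"
  unfolding Truth_def by (intro F1.neg F1.ex_all F1.equal) simp_all

lemma Conj_F1: "(\<And>\<phi>. \<phi> \<in> set \<phi>s \<Longrightarrow> \<phi> \<in> F1 B) \<Longrightarrow> Conj \<phi>s \<in> F1 B"
  by (induction \<phi>s) (simp_all add: Conj_def And_F1 Truth_F1)

lemma Disj_F1: "(\<And>\<phi>. \<phi> \<in> set \<phi>s \<Longrightarrow> \<phi> \<in> F1 B) \<Longrightarrow> Disj \<phi>s \<in> F1 B"
  by (induction \<phi>s) (simp_all add: Disj_def F1.disj F1.neg Truth_F1)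

text \<open>The rule \<open>ex_but_one\<close> asks only for an inclusion of the free variables, so
  0 can be the remaining variable even when it does not occur in \<open>\<phi>\<close>.\<close>

lemma ExBut0_F1:
  assumes "\<phi> \<in> F1 B" shows "ExBut0 \<phi> \<in> F1 B"
  unfolding ExBut0_def by (rule F1.ex_but_one[OF assms, of 0]) auto

lemma ExAll_F1:
  assumes "\<phi> \<in> F1 B" shows "ExAll \<phi> \<in> F1 B"
proof (cases "sorted_list_of_set (fv \<phi>)")
  \<comment> \<open>The rule \<open>ex_all\<close> quantifies a nonempty tuple; a closed formula is
    left unchanged instead.\<close>
  case Nil
  then show ?thesis using assms by (simp add: ExAll_def Exs_def)
next
  case (Cons x xs)
  have "distinct (x # xs)" "set (x # xs) = fv \<phi>"
    using distinct_sorted_list_of_set[of "fv \<phi>"] set_sorted_list_of_set[OF finite_fv, of \<phi>]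
    unfolding Cons by auto
  then show ?thesis unfolding ExAll_def Cons by (intro F1.ex_all assms) auto
qed

section \<open>Satisfaction of the derived connectives and tuple quantifiers\<close>

lemma sat_cong: "(\<And>x. x \<in> fv \<phi> \<Longrightarrow> v x = w x) \<Longrightarrow> sat M v \<phi> = sat M w \<phi>"
proof (induction \<phi> arbitrary: v w)
  case (Or \<phi> \<psi>)
  have "sat M v \<phi> = sat M w \<phi>" "sat M v \<psi> = sat M w \<psi>"
    by (rule Or.IH, simp add: Or.prems)+
  then show ?case by simp
next
  case (Exists x \<phi>)
  have "sat M (v(x := a)) \<phi> = sat M (w(x := a)) \<phi>" for a
    by (rule Exists.IH) (simp add: Exists.prems)
  then show ?case by simp
next
  case (Neg \<phi>)
  have "sat M v \<phi> = sat M w \<phi>"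
    by (rule Neg.IH) (simp add: Neg.prems)
  then show ?case by simp
qed simp_all

lemma sat_And [simp]: "sat M v (And \<phi> \<psi>) \<longleftrightarrow> sat M v \<phi> \<and> sat M v \<psi>"
  by (simp add: And_def)

lemma sat_Truth [simp]: "sat M v Truth"
  by (simp add: Truth_def Exs_def)

lemma sat_Conj [simp]: "sat M v (Conj \<phi>s) \<longleftrightarrow> (\<forall>\<phi>\<in>set \<phi>s. sat M v \<phi>)"
  by (induction \<phi>s) (simp_all add: Conj_def)

lemma sat_Disj [simp]: "sat M v (Disj \<phi>s) \<longleftrightarrow> (\<exists>\<phi>\<in>set \<phi>s. sat M v \<phi>)"
  by (induction \<phi>s) (simp_all add: Disj_def)

lemma sat_Exs:
  "range v \<subseteq> elems M \<Longrightarrow>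
    sat M v (Exs xs \<phi>) \<longleftrightarrow> (\<exists>w. range w \<subseteq> elems M \<and> (\<forall>x. x \<notin> set xs \<longrightarrow> w x = v x) \<and> sat M w \<phi>)"
proof (induction xs arbitrary: v)
  case Nil
  have "w = v" if "\<forall>x. w x = v x" for w using that by auto
  then show ?case using Nil by (auto simp: Exs_def)
next
  case (Cons x xs)
  have "sat M v (Exs (x # xs) \<phi>) \<longleftrightarrow> (\<exists>a\<in>elems M. sat M (v(x := a)) (Exs xs \<phi>))"
    by (simp add: Exs_def)
  also have "\<dots> \<longleftrightarrow> (\<exists>a\<in>elems M. \<exists>w. range w \<subseteq> elems M \<and>
      (\<forall>y. y \<notin> set xs \<longrightarrow> w y = (v(x := a)) y) \<and> sat M w \<phi>)"
  proof (rule bex_cong[OF refl])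
    fix a assume "a \<in> elems M"
    then have "range (v(x := a)) \<subseteq> elems M" using Cons.prems by auto
    then show "sat M (v(x := a)) (Exs xs \<phi>) \<longleftrightarrow> (\<exists>w. range w \<subseteq> elems M \<and>
      (\<forall>y. y \<notin> set xs \<longrightarrow> w y = (v(x := a)) y) \<and> sat M w \<phi>)" by (rule Cons.IH)
  qed
  also have "\<dots> \<longleftrightarrow> (\<exists>w. range w \<subseteq> elems M \<and> (\<forall>y. y \<notin> set (x # xs) \<longrightarrow> w y = v y) \<and> sat M w \<phi>)"
    (is "?L \<longleftrightarrow> ?R")
  proof
    assume ?L
    then obtain a w where w: "range w \<subseteq> elems M" "\<forall>y. y \<notin> set xs \<longrightarrow> w y = (v(x := a)) y" "sat M w \<phi>"
      by blast
    then have "\<forall>y. y \<notin> set (x # xs) \<longrightarrow> w y = v y" by simp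
    with w show ?R by blast
  next
    assume ?R
    then obtain w where w: "range w \<subseteq> elems M" "\<forall>y. y \<notin> set (x # xs) \<longrightarrow> w y = v y" "sat M w \<phi>"
      by blast
    then show ?L by (intro bexI[of _ "w x"] exI[of _ w]) auto
  qed
  finally show ?case .
qed

lemma sat_ExBut0:
  assumes v: "range v \<subseteq> elems M"
  shows "sat M v (ExBut0 \<phi>) \<longleftrightarrow> (\<exists>w. range w \<subseteq> elems M \<and> w 0 = v 0 \<and> sat M w \<phi>)"
proof
  assume "sat M v (ExBut0 \<phi>)"
  then show "\<exists>w. range w \<subseteq> elems M \<and> w 0 = v 0 \<and> sat M w \<phi>"
    unfolding ExBut0_def sat_Exs[OF v] by auto
next
  assume "\<exists>w. range w \<subseteq> elems M \<and> w 0 = v 0 \<and> sat M w \<phi>"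
  then obtain w where w: "range w \<subseteq> elems M" "w 0 = v 0" "sat M w \<phi>" by blast
  \<comment> \<open>The tuple lists only variables free in \<open>\<phi>\<close>, so all others must
    be reset to their values under \<open>v\<close>.\<close>
  define w' where "w' x = (if x \<in> fv \<phi> then w x else v x)" for x
  have "sat M w' \<phi>" using w(3) sat_cong[of \<phi> w' w] by (simp add: w'_def)
  moreover have "range w' \<subseteq> elems M" using v w(1) by (auto simp: w'_def)
  ultimately show "sat M v (ExBut0 \<phi>)"
    unfolding ExBut0_def sat_Exs[OF v] using w(2) by (intro exI[of _ w']) (auto simp: w'_def)
qed

lemma sat_ExAll:
  assumes v: "range v \<subseteq> elems M"
  shows "sat M v (ExAll \<phi>) \<longleftrightarrow> (\<exists>w. range w \<subseteq> elems M \<and> sat M w \<phi>)"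
proof
  assume "sat M v (ExAll \<phi>)"
  then show "\<exists>w. range w \<subseteq> elems M \<and> sat M w \<phi>"
    unfolding ExAll_def sat_Exs[OF v] by auto
next
  assume "\<exists>w. range w \<subseteq> elems M \<and> sat M w \<phi>"
  then obtain w where w: "range w \<subseteq> elems M" "sat M w \<phi>" by blast
  define w' where "w' x = (if x \<in> fv \<phi> then w x else v x)" for x
  have "sat M w' \<phi>" using w(2) sat_cong[of \<phi> w' w] by (simp add: w'_def)
  moreover have "range w' \<subseteq> elems M" using v w(1) by (auto simp: w'_def)
  ultimately show "sat M v (ExAll \<phi>)"
    unfolding ExAll_def sat_Exs[OF v] by (intro exI[of _ w']) (auto simp: w'_def)
qed


section \<open>Logic programs over the natural numbers\<close>

datatype 'l atom = Fact 'l "nat list" | IsZero nat | IsSuc nat nat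

type_synonym 'l clause = "nat list \<times> 'l atom list"

primrec holds :: "('l \<times> nat list) set \<Rightarrow> (nat \<Rightarrow> nat) \<Rightarrow> 'l atom \<Rightarrow> bool" where
  "holds D e (Fact l vs) \<longleftrightarrow> (l, map e vs) \<in> D"
| "holds D e (IsZero v) \<longleftrightarrow> e v = 0"
| "holds D e (IsSuc v w) \<longleftrightarrow> e w = Suc (e v)"

text \<open>Support may be circular, unlike membership in a least model: it is a local condition at
  each fact, which is what a formula can impose. \<open>V\<close> confines the clause variables to
  the numbers available in the word.\<close>

definition supported :: "('l \<Rightarrow> 'l clause list) \<Rightarrow> nat set \<Rightarrow> ('l \<times> nat list) set \<Rightarrow> bool" where
  "supported P V D \<longleftrightarrow> (\<forall>l args. (l, args) \<in> D \<longrightarrow>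
     (\<exists>h b e. (h, b) \<in> set (P l) \<and> range e \<subseteq> V \<and> args = map e h \<and> (\<forall>a \<in> set b. holds D e a)))"

text \<open>Finiteness of \<open>D\<close> and the bound \<open>K\<close> are what allows the facts
  to be stored in a finite word.\<close>

definition derivable :: "('l \<Rightarrow> 'l clause list) \<Rightarrow> 'l \<Rightarrow> nat list \<Rightarrow> bool" where
  "derivable P l args \<longleftrightarrow> (\<exists>K D. finite D \<and> supported P {..K} D \<and> (l, args) \<in> D)"

lemma holds_mono: "holds D e a \<Longrightarrow> D \<subseteq> D' \<Longrightarrow> holds D' e a"
  by (cases a) auto

lemma supportedE:
  assumes "supported P V D" "(l, args) \<in> D"
  obtains h b e where "(h, b) \<in> set (P l)" "range e \<subseteq> V" "args = map e h"
    "\<forall>a\<in>set b. holds D e a"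
  using assms unfolding supported_def by metis

text \<open>A justification survives in a larger set of facts and under a larger bound. Hence the
  finite supported sets of the body facts can be merged, and the head added to their union.\<close>

lemma derivableI:
  assumes clause: "(h, b) \<in> set (P l)" and fin: "finite (range e)" and args: "args = map e h"
    and body: "\<And>l' vs. Fact l' vs \<in> set b \<Longrightarrow> derivable P l' (map e vs)"
      "\<And>v. IsZero v \<in> set b \<Longrightarrow> e v = 0"
      "\<And>v w. IsSuc v w \<in> set b \<Longrightarrow> e w = Suc (e v)"
  shows "derivable P l args"
proof -
  define F where "F = {d. \<exists>l vs. Fact l vs \<in> set b \<and> d = (l, map e vs)}"
  have "F = (\<lambda>a. case a of Fact l vs \<Rightarrow> (l, map e vs)) ` {a \<in> set b. \<exists>l vs. a = Fact l vs}"
    by (force simp: F_def image_iff)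
  then have finF: "finite F" by simp
  have "\<forall>d\<in>F. \<exists>K D. finite D \<and> supported P {..K} D \<and> d \<in> D"
    using body(1) by (auto simp: F_def derivable_def)
  then obtain K D where KD: "\<And>d. d \<in> F \<Longrightarrow> finite (D d) \<and> supported P {..K d} (D d) \<and> d \<in> D d"
    by metis
  obtain K0 where K0: "\<And>v. e v \<le> K0"
    using finite_nat_set_iff_bounded_le[of "range e"] fin by auto
  define K' where "K' = Max (insert K0 (K ` F))"
  define D' where "D' = insert (l, args) (\<Union>d\<in>F. D d)"
  have KK: "K d \<le> K'" if "d \<in> F" for d unfolding K'_def using finF that by simp
  have K0': "K0 \<le> K'" unfolding K'_def using finF by simp
  have "supported P {..K'} D'"
    unfolding supported_def
  proof (intro allI impI)
    fix l' args' assume "(l', args') \<in> D'"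
    then consider "l' = l" "args' = args" | d where "d \<in> F" "(l', args') \<in> D d"
      by (auto simp: D'_def)
    then show "\<exists>h b e. (h, b) \<in> set (P l') \<and> range e \<subseteq> {..K'} \<and> args' = map e h \<and>
      (\<forall>a\<in>set b. holds D' e a)"
    proof cases
      case 1
      have "holds D' e a" if "a \<in> set b" for a
      proof (cases a)
        case (Fact l vs)
        then have "(l, map e vs) \<in> F" using that by (auto simp: F_def)
        then show ?thesis using KD Fact by (force simp: D'_def)
      qed (use that body in auto)
      moreover have "range e \<subseteq> {..K'}" using K0 K0' order_trans by blast
      ultimately show ?thesis using 1 clause args by blast
    next
      case 2
      then have "supported P {..K d} (D d)" using KD by blast
      then obtain h b e where *: "(h, b) \<in> set (P l')" "range e \<subseteq> {..K d}" "args' = map e h"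
        "\<forall>a\<in>set b. holds (D d) e a" using 2(2) by (rule supportedE)
      have "D d \<subseteq> D'" using 2 by (auto simp: D'_def)
      then have "\<forall>a\<in>set b. holds D' e a" using *(4) holds_mono by blast
      moreover have "range e \<subseteq> {..K'}" by (rule subset_trans[OF *(2)]) (simp add: KK[OF 2(1)])
      ultimately show ?thesis using * by blast
    qed
  qed
  moreover have "finite D'" using finF KD by (simp add: D'_def)
  ultimately show ?thesis unfolding derivable_def D'_def by blast
qed


section \<open>Evaluation of \<open>\<mu>\<close>-recursive functions as a logic program\<close>

text \<open>
  The fact \<open>Eval f k\<close> of \<open>y # xs\<close> means that \<open>f\<close> evaluates on the \<open>k\<close>-tuple \<open>xs\<close> to \<open>y\<close>, and
  \<open>Pos f k\<close> of \<open>n # xs\<close> means that \<open>f\<close> is positive on \<open>m # xs\<close> for all \<open>m < n\<close>.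
  In the clauses the variables below \<open>k\<close> stand for the parameters; those of \<open>PrimRec\<close> exclude
  the recursion argument, which is the variable \<open>k + 1\<close>.
\<close>

datatype lab = Eval recf nat | Pos recf nat

instance recf :: countable by countable_datatype
instance lab :: countable by countable_datatype

fun prog :: "lab \<Rightarrow> lab clause list" where
  "prog (Eval Zero k) = [(k # [0..<k], [IsZero k])]"
| "prog (Eval Succr k) = (if k = 1 then [([1, 0], [IsSuc 0 1])] else [])"
| "prog (Eval (Proj i) k) = (if i < k then [(i # [0..<k], [])] else [])"
| "prog (Eval (Comp f gs) k) =
     [(k # [0..<k], Fact (Eval f (length gs)) (k # [Suc k..<Suc k + length gs])
        # map (\<lambda>i. Fact (Eval (gs ! i) k) ((Suc k + i) # [0..<k])) [0..<length gs])]"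
| "prog (Eval (PrimRec f g) 0) = []"
| "prog (Eval (PrimRec f g) (Suc k)) =
     [(k # (k + 1) # [0..<k], [IsZero (k + 1), Fact (Eval f k) (k # [0..<k])]),
      (k # (k + 1) # [0..<k],
        [IsSuc (k + 2) (k + 1), Fact (Eval (PrimRec f g) (Suc k)) ((k + 3) # (k + 2) # [0..<k]),
         Fact (Eval g (k + 2)) (k # (k + 2) # (k + 3) # [0..<k])])]"
| "prog (Eval (Mu f) k) =
     [(k # [0..<k], [IsZero (k + 1), Fact (Eval f (k + 1)) ((k + 1) # k # [0..<k]),
        Fact (Pos f k) (k # [0..<k])])]"
| "prog (Pos f k) =
     [(k # [0..<k], [IsZero k]),
      (k # [0..<k], [IsSuc (k + 1) k, IsSuc (k + 3) (k + 2), Fact (Pos f k) ((k + 1) # [0..<k]),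
         Fact (Eval f (k + 1)) ((k + 2) # (k + 1) # [0..<k])])]"

primrec arity :: "lab \<Rightarrow> nat" where
  "arity (Eval f k) = Suc k"
| "arity (Pos f k) = Suc k"

text \<open>A finite set of labels that contains \<open>Eval f k\<close> and is closed under passing
  to clause bodies, so finitely many rule formulas suffice.\<close>

fun labs :: "recf \<Rightarrow> nat \<Rightarrow> lab set" where
  "labs Zero k = {Eval Zero k}"
| "labs Succr k = {Eval Succr k}"
| "labs (Proj i) k = {Eval (Proj i) k}"
| "labs (Comp f gs) k = insert (Eval (Comp f gs) k) (labs f (length gs) \<union> (\<Union>g\<in>set gs. labs g k))"
| "labs (PrimRec f g) k = insert (Eval (PrimRec f g) k) (labs f (k - 1) \<union> labs g (k + 1))"
| "labs (Mu f) k = insert (Eval (Mu f) k) (insert (Pos f k) (labs f (k + 1)))"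

lemma finite_labs: "finite (labs f k)"
  by (induction f k rule: labs.induct) auto

lemma Eval_labs: "Eval f k \<in> labs f k"
  by (cases f) auto

lemma length_head: "(h, b) \<in> set (prog l) \<Longrightarrow> length h = arity l"
  by (cases l rule: prog.cases) (auto split: if_splits)

lemma length_Fact:
  "(h, b) \<in> set (prog l) \<Longrightarrow> Fact l' vs \<in> set b \<Longrightarrow> length vs = arity l'"
  by (cases l rule: prog.cases) (auto simp del: upt_Suc split: if_splits)

lemma labs_closed:
  "l \<in> labs f k \<Longrightarrow> (h, b) \<in> set (prog l) \<Longrightarrow> Fact l' vs \<in> set b \<Longrightarrow> l' \<in> labs f k"
proof (induction f k rule: labs.induct)
  case (4 f gs k)
  then consider "l = Eval (Comp f gs) k" | "l \<in> labs f (length gs)" | g where "g \<in> set gs" "l \<in> labs g k"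
    by auto
  then show ?case
  proof cases
    case 1
    with "4.prems" consider "l' = Eval f (length gs)" | g where "g \<in> set gs" "l' = Eval g k"
      using nth_mem by (fastforce simp del: upt_Suc)
    then show ?thesis by cases (use Eval_labs in auto)
  qed (use 4 in auto)
next
  case (5 f g k)
  then consider "l = Eval (PrimRec f g) k" | "l \<in> labs f (k - 1)" | "l \<in> labs g (k + 1)"
    by auto
  then show ?case
    by cases (use 5 Eval_labs in \<open>(cases k; auto)+\<close>)
next
  case (6 f k)
  then consider "l = Eval (Mu f) k" | "l = Pos f k" | "l \<in> labs f (k + 1)"
    by auto
  then show ?case
    by cases (use 6 Eval_labs in \<open>auto\<close>)
qed (auto split: if_splits)

text \<open>Circular support is impossible for this program: a body refers to a proper subterm, or,
  for \<open>PrimRec\<close> and \<open>Pos\<close>, to the same term with a smaller number.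
  Structural induction is therefore combined with inductions on that number.\<close>

lemma prog_sound:
  assumes D: "supported prog UNIV D"
  shows "(Eval f k, y # xs) \<in> D \<Longrightarrow> evaluates f xs y"
proof (induction f arbitrary: k y xs)
  case Zero
  then show ?case by (rule supportedE[OF D]) (auto intro: evaluates.intros)
next
  case Succr
  then show ?case by (rule supportedE[OF D]) (auto intro: evaluates.intros split: if_splits)
next
  case (Proj i)
  from Proj obtain e where "i < k" "y # xs = map e (i # [0..<k])"
    by (rule supportedE[OF D]) (auto split: if_splits)
  then show ?case using evaluates.intros(3)[of i xs] by auto
next
  case (Comp f gs)
  from Comp.prems obtain e where e: "y # xs = map e (k # [0..<k])"
    "(Eval f (length gs), map e (k # [Suc k..<Suc k + length gs])) \<in> D"
    "\<And>i. i < length gs \<Longrightarrow> (Eval (gs ! i) k, map e ((Suc k + i) # [0..<k])) \<in> D"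
  proof (rule supportedE[OF D])
    fix h b e
    assume *: "(h, b) \<in> set (prog (Eval (Comp f gs) k))" "y # xs = map e h"
      "\<forall>a\<in>set b. holds D e a"
    show thesis
    proof (rule that)
      show "y # xs = map e (k # [0..<k])" using * by simp
      show "(Eval f (length gs), map e (k # [Suc k..<Suc k + length gs])) \<in> D"
        using *(1) *(3)[rule_format, of "Fact (Eval f (length gs)) (k # [Suc k..<Suc k + length gs])"]
        by (simp del: upt_Suc)
      show "(Eval (gs ! i) k, map e ((Suc k + i) # [0..<k])) \<in> D" if "i < length gs" for i
        using *(1) *(3)[rule_format, of "Fact (Eval (gs ! i) k) ((Suc k + i) # [0..<k])"] that
        by (simp del: upt_Suc)
    qed
  qed
  have "evaluates f (map e [Suc k..<Suc k + length gs]) y"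
    using e(1,2) Comp.IH(1) by auto
  moreover have "evaluates (gs ! i) xs (e (Suc k + i))" if "i < length gs" for i
    using e(1) e(3)[OF that] Comp.IH(2)[of "gs ! i"] that by auto
  then have "list_all2 (\<lambda>g z. evaluates g xs z) gs (map e [Suc k..<Suc k + length gs])"
    by (auto simp: list_all2_conv_all_nth simp del: upt_Suc)
  ultimately show ?case by (intro evaluates.intros(4))
next
  case (PrimRec f g)
  \<comment> \<open>One clause is unfolded, and its subterm facts are replaced by evaluations
    through the structural induction hypothesis; the recursive fact is left to the induction on
    \<open>n\<close>.\<close>
  have step: "(n = 0 \<and> evaluates f xs y) \<or> (\<exists>m z. n = Suc m \<and> (Eval (PrimRec f g) k, z # m # xs) \<in> D
      \<and> evaluates g (m # z # xs) y)" if fact: "(Eval (PrimRec f g) k, y # n # xs) \<in> D" for n y xs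
  proof -
    obtain h b e where *: "(h, b) \<in> set (prog (Eval (PrimRec f g) k))"
      "y # n # xs = map e h" "\<forall>a\<in>set b. holds D e a"
      by (rule supportedE[OF D fact])
    from *(1) obtain j where k: "k = Suc j" by (cases k) auto
    from *(1) consider
        "h = j # (j + 1) # [0..<j]" "b = [IsZero (j + 1), Fact (Eval f j) (j # [0..<j])]"
      | "h = j # (j + 1) # [0..<j]" "b = [IsSuc (j + 2) (j + 1),
          Fact (Eval (PrimRec f g) (Suc j)) ((j + 3) # (j + 2) # [0..<j]),
          Fact (Eval g (j + 2)) (j # (j + 2) # (j + 3) # [0..<j])]"
      by (auto simp: k)
    then show ?thesis
    proof cases
      case 1
      then show ?thesis using * PrimRec.IH(1)[of j y xs] by simp
    next
      case 2
      have "n = Suc (e (j + 2))" "(Eval (PrimRec f g) k, e (j + 3) # e (j + 2) # xs) \<in> D"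
        using *(2,3) 2 k by simp_all
      moreover have "evaluates g (e (j + 2) # e (j + 3) # xs) y"
        using *(2,3) 2 PrimRec.IH(2)[of "j + 2"] by simp
      ultimately show ?thesis by blast
    qed
  qed
  have "(Eval (PrimRec f g) k, y # n # xs) \<in> D \<Longrightarrow> evaluates (PrimRec f g) (n # xs) y" for n y xs
  proof (induction n arbitrary: y)
    case 0
    then show ?case using step[OF 0] by (auto intro: evaluates.intros)
  next
    case (Suc n)
    then show ?case using step[OF Suc.prems] by (auto intro: evaluates.intros)
  qed
  \<comment> \<open>\<open>PrimRec\<close> has no clause for \<open>k = 0\<close>, so a supported
    fact has a recursion argument.\<close>
  moreover obtain n xs' where "xs = n # xs'"
  proof -
    obtain h b e where *: "(h, b) \<in> set (prog (Eval (PrimRec f g) k))"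
      "y # xs = map e h"
      by (rule supportedE[OF D PrimRec.prems])
    then show ?thesis using that by (cases k) auto
  qed
  ultimately show ?case using PrimRec.prems by blast
next
  case (Mu f)
  have step: "n = 0 \<or> (\<exists>m y. n = Suc m \<and> (Pos f k, m # xs) \<in> D \<and> evaluates f (m # xs) (Suc y))"
    if fact: "(Pos f k, n # xs) \<in> D" for n
  proof -
    obtain h b e where *: "(h, b) \<in> set (prog (Pos f k))"
      "n # xs = map e h" "\<forall>a\<in>set b. holds D e a"
      by (rule supportedE[OF D fact])
    from *(1) consider "h = k # [0..<k]" "b = [IsZero k]"
      | "h = k # [0..<k]" "b = [IsSuc (k + 1) k, IsSuc (k + 3) (k + 2),
          Fact (Pos f k) ((k + 1) # [0..<k]), Fact (Eval f (k + 1)) ((k + 2) # (k + 1) # [0..<k])]"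
      by auto
    then show ?thesis
    proof cases
      case 1
      then show ?thesis using * by simp
    next
      case 2
      have "n = Suc (e (k + 1))" "(Pos f k, e (k + 1) # xs) \<in> D" "e (k + 2) = Suc (e (k + 3))"
        using *(2,3) 2 by simp_all
      moreover have "evaluates f (e (k + 1) # xs) (e (k + 2))"
        by (rule Mu.IH[of "k + 1"]) (use *(2,3) 2 in auto)
      ultimately show ?thesis by auto
    qed
  qed
  have pos: "(Pos f k, n # xs) \<in> D \<Longrightarrow> \<forall>m<n. \<exists>y. evaluates f (m # xs) (Suc y)" for n
  proof (induction n)
    case (Suc n)
    then show ?case using step[OF Suc.prems] by (auto simp: less_Suc_eq)
  qed simp
  obtain h b e where *: "(h, b) \<in> set (prog (Eval (Mu f) k))"
      "y # xs = map e h" "\<forall>a\<in>set b. holds D e a"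
    by (rule supportedE[OF D Mu.prems])
  have hb: "h = k # [0..<k]" "b = [IsZero (k + 1), Fact (Eval f (k + 1)) ((k + 1) # k # [0..<k]),
      Fact (Pos f k) (k # [0..<k])]"
    using *(1) by simp_all
  have "evaluates f (y # xs) 0"
    by (rule Mu.IH[of "k + 1"]) (use *(2,3) hb in auto)
  moreover have "(Pos f k, y # xs) \<in> D"
    using *(2,3) hb by simp
  ultimately show ?case by (intro evaluates.intros(7) pos)
qed

section \<open>Completeness of the evaluation program\<close>

text \<open>Clause variables are valued by a list, with the parameters first. The default 0 keeps
  the range finite, as \<open>derivableI\<close> requires.\<close>

definition val :: "nat list \<Rightarrow> nat \<Rightarrow> nat" where
  "val zs v = (if v < length zs then zs ! v else 0)"

lemma finite_range_val: "finite (range (val zs))"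
proof (rule finite_subset)
  show "range (val zs) \<subseteq> insert 0 (set zs)" by (auto simp: val_def)
qed simp

lemma map_val [simp]: "map (val (xs @ ys)) [0..<length xs] = xs"
  by (rule nth_equalityI) (auto simp: val_def nth_append)

lemma val_append [simp]:
  "val (xs @ y # ys) (length xs) = y"
  "val (xs @ y # z # ys) (Suc (length xs)) = z"
  "val (xs @ y # z # u # ys) (Suc (Suc (length xs))) = u"
  "val (xs @ y # z # u # w # ys) (Suc (Suc (Suc (length xs)))) = w"
  by (auto simp: val_def nth_append)

lemma val_Cons [simp]: "val (y # ys) 0 = y" "val (y # ys) (Suc i) = val ys i"
  by (auto simp: val_def)

lemma prog_complete:
  "evaluates f xs y \<Longrightarrow> derivable prog (Eval f (length xs)) (y # xs)"
proof (induction f xs y rule: evaluates.induct)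
  case (1 xs)
  show ?case by (rule derivableI[OF _ finite_range_val[of "xs @ [0]"]]) auto
next
  case (2 x)
  show ?case by (rule derivableI[OF _ finite_range_val[of "[x, Suc x]"]]) auto
next
  case (3 i xs)
  have "map (val xs) [0..<length xs] = xs" using map_val[of xs "[]"] by simp
  then show ?case using 3
    by - (rule derivableI[of "i # [0..<length xs]" "[]", OF _ finite_range_val[of xs]], auto simp: val_def)
next
  case (4 xs gs ys f z)
  let ?e = "val (xs @ z # ys)"
  have len: "length gs = length ys" using 4(1) by (rule list_all2_lengthD)
  have ys: "map ?e [Suc (length xs)..<Suc (length xs) + length ys] = ys"
    by (rule nth_equalityI) (auto simp: val_def nth_append simp del: upt_Suc)
  show ?case
  proof (rule derivableI[OF _ finite_range_val[of "xs @ z # ys"]])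
    fix l' vs
    assume "Fact l' vs \<in> set (Fact (Eval f (length gs))
        (length xs # [Suc (length xs)..<Suc (length xs) + length gs])
        # map (\<lambda>i. Fact (Eval (gs ! i) (length xs)) ((Suc (length xs) + i) # [0..<length xs]))
            [0..<length gs])"
    then consider "l' = Eval f (length gs)"
        "vs = length xs # [Suc (length xs)..<Suc (length xs) + length gs]"
      | i where "i < length gs" "l' = Eval (gs ! i) (length xs)"
        "vs = (Suc (length xs) + i) # [0..<length xs]"
      by (auto simp del: upt_Suc)
    then show "derivable prog l' (map ?e vs)"
    proof cases
      case 1
      then show ?thesis using ys "4.IH" len by (simp del: upt_Suc)
    next
      case 2
      then have "derivable prog l' (ys ! i # xs)"
        using 4(1) by (auto simp: list_all2_conv_all_nth)
      moreover have "?e (Suc (length xs + i)) = ys ! i" using 2 len by (simp add: val_def nth_append)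
      ultimately show ?thesis using 2 by simp
    qed
  qed (auto simp del: upt_Suc)
next
  case (5 f xs y g)
  show ?case
    by (rule derivableI[of "length xs # (length xs + 1) # [0..<length xs]"
          "[IsZero (length xs + 1), Fact (Eval f (length xs)) (length xs # [0..<length xs])]",
          OF _ finite_range_val[of "xs @ [y, 0]"]])
      (use "5.IH" in \<open>auto simp: numeral_eq_Suc\<close>)
next
  case (6 f g n xs y z)
  show ?case
    by (rule derivableI[of "length xs # (length xs + 1) # [0..<length xs]"
          "[IsSuc (length xs + 2) (length xs + 1),
            Fact (Eval (PrimRec f g) (Suc (length xs))) ((length xs + 3) # (length xs + 2) # [0..<length xs]),
            Fact (Eval g (length xs + 2)) (length xs # (length xs + 2) # (length xs + 3) # [0..<length xs])]",
          OF _ finite_range_val[of "xs @ [z, Suc n, n, y]"]])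
      (use "6.IH" in \<open>auto simp: numeral_eq_Suc\<close>)
next
  case (7 f n xs)
  \<comment> \<open>The \<open>Pos\<close> facts are built up from 0 to \<open>n\<close>; each step
    uses the positive value that the minimization rule provides at \<open>m < n\<close>.\<close>
  have pos: "m \<le> n \<Longrightarrow> derivable prog (Pos f (length xs)) (m # xs)" for m
  proof (induction m)
    case 0
    show ?case
      by (rule derivableI[of "length xs # [0..<length xs]" "[IsZero (length xs)]",
          OF _ finite_range_val[of "xs @ [0]"]]) auto
  next
    case (Suc m)
    then have "m < n" by simp
    with 7 obtain y where "derivable prog (Eval f (length (m # xs))) (Suc y # m # xs)"
      by blast
    then have y: "derivable prog (Eval f (Suc (length xs))) (Suc y # m # xs)" by simp
    have m: "derivable prog (Pos f (length xs)) (m # xs)" using Suc by simp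
    show ?case
      by (rule derivableI[of "length xs # [0..<length xs]"
            "[IsSuc (length xs + 1) (length xs), IsSuc (length xs + 3) (length xs + 2),
              Fact (Pos f (length xs)) ((length xs + 1) # [0..<length xs]),
              Fact (Eval f (length xs + 1)) ((length xs + 2) # (length xs + 1) # [0..<length xs])]",
            OF _ finite_range_val[of "xs @ [Suc m, m, Suc y, y]"]])
        (use y m in \<open>auto simp: numeral_eq_Suc\<close>)
  qed
  show ?case
    by (rule derivableI[of "length xs # [0..<length xs]"
          "[IsZero (length xs + 1), Fact (Eval f (length xs + 1)) ((length xs + 1) # length xs # [0..<length xs]),
            Fact (Pos f (length xs)) (length xs # [0..<length xs])]",
          OF _ finite_range_val[of "xs @ [n, 0]"]])
      (use "7.IH" pos[of n] in \<open>auto simp: numeral_eq_Suc\<close>)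
qed

section \<open>Logic programs as one-dimensional formulas\<close>

text \<open>
  A number is represented by the position of the word with that index; only positions in the
  symbol 0 may be referred to by data values. A fact \<open>(l, [n\<^sub>1, \<dots>, n\<^sub>k])\<close> is a block of
  \<open>k + 1\<close> consecutive positions: a head carrying the symbol of \<open>l\<close>, and then positions that
  have the data values of the positions \<open>n\<^sub>1, \<dots>, n\<^sub>k\<close>. Symbol 1 marks the first position of the
  word and symbol 2 the input.
\<close>

definition lab_sym :: "'l::countable \<Rightarrow> nat" where
  "lab_sym l = 3 + to_nat l"

text \<open>
  \<open>num_var v\<close> is the position representing the program variable \<open>v\<close>, and \<open>block_var j i\<close> is the
  \<open>i\<close>-th position of the block of the \<open>j\<close>-th atom; \<open>block_var 0 0 = 0\<close> is the head of the
  fact that a clause is to support.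
\<close>

definition num_var :: "nat \<Rightarrow> nat" where
  "num_var v = 2 * v + 1"

definition block_var :: "nat \<Rightarrow> nat \<Rightarrow> nat" where
  "block_var j i = 2 * prod_encode (j, i)"

lemma block_var_0 [simp]: "block_var 0 0 = 0"
  by (simp add: block_var_def prod_encode_def)

text \<open>The atoms of a body share the \<open>num_var\<close> positions, so a clause variable has
  one value throughout, while \<open>j\<close> gives each atom block variables of its own. Equality
  of data values links a block position to the number it names.\<close>

primrec atom_fo :: "nat \<Rightarrow> 'l::countable atom \<Rightarrow> fo" where
  "atom_fo j (Fact l vs) = And (Unary (lab_sym l) (block_var j 0))
     (Conj (map (\<lambda>i. And (Binary Succ (block_var j i) (block_var j (Suc i)))
        (And (Binary Sim (block_var j (Suc i)) (num_var (vs ! i))) (Unary 0 (num_var (vs ! i)))))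
        [0..<length vs]))"
| "atom_fo j (IsZero v) = Unary 1 (num_var v)"
| "atom_fo j (IsSuc v w) = Binary Succ (num_var v) (num_var w)"

definition body_fo :: "'l::countable atom list \<Rightarrow> fo" where
  "body_fo b = Conj (map (\<lambda>j. atom_fo j (b ! j)) [0..<length b])"

text \<open>With the head prefixed as atom 0, its block starts at variable 0, the position under
  scrutiny. All other variables are quantified inside each disjunct, which keeps the formula
  one-dimensional.\<close>

definition rule_fo :: "('l::countable \<Rightarrow> 'l clause list) \<Rightarrow> 'l \<Rightarrow> fo" where
  "rule_fo P l = Neg (ExAll (And (Unary (lab_sym l) 0)
     (Neg (Disj (map (\<lambda>(h, b). ExBut0 (body_fo (Fact l h # b))) (P l))))))"

definition first_fo :: fo where
  "first_fo = Neg (ExAll (And (Unary 1 0) (Binary Succ 1 0)))"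

text \<open>Makes the data value of a block position name at most one number.\<close>

definition num_fo :: fo where
  "num_fo = Neg (ExAll (And (And (Unary 0 0) (Unary 0 1)) (And (Binary Sim 0 1) (Neg (Equal 0 1)))))"

definition unique_fo :: fo where
  "unique_fo = Neg (ExAll (And (And (Unary 2 0) (Unary 2 1)) (Neg (Equal 0 1))))"

text \<open>Clause variable 0 is the output, required to be zero, and clause variable 1 the
  argument, required to carry symbol 2. The input is fixed only by \<open>input_fo\<close>, so this
  formula can be fed its own code.\<close>

definition goal_fo :: "'l::countable \<Rightarrow> fo" where
  "goal_fo l = ExAll (And (Unary 2 (num_var 1)) (body_fo [Fact l [0, 1], IsZero 0]))"

definition program_fo :: "('l::countable \<Rightarrow> 'l clause list) \<Rightarrow> 'l list \<Rightarrow> 'l \<Rightarrow> fo" where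
  "program_fo P ls l = Conj (first_fo # num_fo # unique_fo # goal_fo l # map (rule_fo P) ls)"

text \<open>A fresh variable at each stage avoids capture and leaves exactly one free variable. The
  recursion also makes the code of the formula primitive recursive in \<open>n\<close>.\<close>

primrec index_fo :: "nat \<Rightarrow> fo" where
  "index_fo 0 = Unary 1 0"
| "index_fo (Suc n) = Exists n (And (Binary Succ n (Suc n)) (index_fo n))"

definition input_fo :: "nat \<Rightarrow> fo" where
  "input_fo n = Exists n (And (Unary 2 n) (index_fo n))"

section \<open>Free variables and membership in the fragment\<close>

lemma fv_index_fo [simp]: "fv (index_fo n) = {n}"
  by (induction n) auto

lemma fv_input_fo [simp]: "fv (input_fo n) = {}"
  by (simp add: input_fo_def)

lemma index_fo_F1: "index_fo n \<in> F1 {Succ, Sim}"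
proof (induction n)
  case 0
  show ?case by (simp add: F1.unary)
next
  case (Suc n)
  have "Exs [n] (And (Binary Succ n (Suc n)) (index_fo n)) \<in> F1 {Succ, Sim}"
    by (rule F1.ex_but_one[of _ _ "Suc n"]) (auto intro!: And_F1 F1.binary Suc)
  then show ?case by (simp add: Exs_def)
qed

lemma input_fo_F1: "input_fo n \<in> F1 {Succ, Sim}"
proof -
  have "Exs [n] (And (Unary 2 n) (index_fo n)) \<in> F1 {Succ, Sim}"
    by (rule F1.ex_all) (auto intro!: And_F1 F1.unary index_fo_F1)
  then show ?thesis by (simp add: Exs_def input_fo_def)
qed

lemma atom_fo_F1: "atom_fo j a \<in> F1 {Succ, Sim}"
  by (cases a) (auto intro!: And_F1 Conj_F1 F1.unary F1.binary)

lemma body_fo_F1: "body_fo b \<in> F1 {Succ, Sim}"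
  by (auto simp: body_fo_def intro!: Conj_F1 atom_fo_F1)

lemma rule_fo_F1: "rule_fo P l \<in> F1 {Succ, Sim}"
  by (auto simp: rule_fo_def intro!: F1.neg ExAll_F1 And_F1 F1.unary Disj_F1 ExBut0_F1 body_fo_F1)

lemma program_fo_F1: "program_fo P ls l \<in> F1 {Succ, Sim}"
  unfolding program_fo_def
  by (rule Conj_F1) (auto simp: first_fo_def num_fo_def unique_fo_def goal_fo_def intro!: rule_fo_F1
    body_fo_F1 F1.neg ExAll_F1 And_F1 F1.unary F1.binary F1.equal)

lemma fv_program_fo: "fv (program_fo P ls l) = {}"
  by (auto simp: program_fo_def first_fo_def num_fo_def unique_fo_def goal_fo_def rule_fo_def)

definition block :: "'a struct \<Rightarrow> 'l::countable \<Rightarrow> (nat \<Rightarrow> 'a) \<Rightarrow> 'a list \<Rightarrow> bool" where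
  "block M l p us \<longleftrightarrow> p 0 \<in> un M (lab_sym l) \<and> (\<forall>i < length us.
     (p i, p (Suc i)) \<in> rel M Succ \<and> (p (Suc i), us ! i) \<in> rel M Sim \<and> us ! i \<in> un M 0)"

lemma sat_Fact:
  "sat M w (atom_fo j (Fact l vs)) \<longleftrightarrow>
    block M l (\<lambda>i. w (block_var j i)) (map (\<lambda>v. w (num_var v)) vs)"
  by (auto simp: block_def)

lemma sat_body_fo: "sat M w (body_fo b) \<longleftrightarrow> (\<forall>j<length b. sat M w (atom_fo j (b ! j)))"
  by (auto simp: body_fo_def)


section \<open>From words to supported facts\<close>

text \<open>The common ground of finite and \<open>\<omega>\<close>-words. The natural number
  \<open>idx\<close> stands in for the order, which the formulas cannot mention.\<close>

locale indexed_word =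
  fixes M :: "'a struct" and idx :: "'a \<Rightarrow> nat"
  assumes nonempty: "elems M \<noteq> {}"
    and un_sub: "un M p \<subseteq> elems M" and rel_sub: "rel M b \<subseteq> elems M \<times> elems M"
    and Succ_idx: "(x, y) \<in> rel M Succ \<Longrightarrow> idx y = Suc (idx x)"
    and first_idx: "x \<in> elems M \<Longrightarrow> (\<And>y. (y, x) \<notin> rel M Succ) \<Longrightarrow> idx x = 0"
    and Succ_unique: "(x, y) \<in> rel M Succ \<Longrightarrow> (x, z) \<in> rel M Succ \<Longrightarrow> y = z"
    and Sim_equiv: "equiv (elems M) (rel M Sim)"
begin

context
  fixes v :: "nat \<Rightarrow> 'a"
  assumes v: "range v \<subseteq> elems M"
begin

lemma first_foD:
  assumes "sat M v first_fo" "x \<in> un M 1" shows "idx x = 0"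
proof (rule first_idx)
  show "x \<in> elems M" using assms(2) un_sub by blast
  fix y show "(y, x) \<notin> rel M Succ"
  proof
    assume yx: "(y, x) \<in> rel M Succ"
    let ?w = "\<lambda>i::nat. if i = 0 then x else y"
    have "range ?w \<subseteq> elems M" using yx rel_sub by auto
    moreover have "sat M ?w (And (Unary 1 0) (Binary Succ 1 0))" using yx assms(2) by simp
    ultimately show False using assms(1) unfolding first_fo_def sat.simps sat_ExAll[OF v] by blast
  qed
qed

lemma num_foD:
  assumes "sat M v num_fo" "x \<in> un M 0" "y \<in> un M 0" "(x, y) \<in> rel M Sim" shows "x = y"
proof (rule ccontr)
  assume ne: "x \<noteq> y"
  let ?w = "\<lambda>i::nat. if i = 0 then x else y"
  have "range ?w \<subseteq> elems M" using assms rel_sub by auto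
  moreover have "sat M ?w (And (And (Unary 0 0) (Unary 0 1)) (And (Binary Sim 0 1) (Neg (Equal 0 1))))"
    using ne assms by simp
  ultimately show False using assms(1) unfolding num_fo_def sat.simps sat_ExAll[OF v] by blast
qed

lemma unique_foD:
  assumes "sat M v unique_fo" "x \<in> un M 2" "y \<in> un M 2" shows "x = y"
proof (rule ccontr)
  assume ne: "x \<noteq> y"
  let ?w = "\<lambda>i::nat. if i = 0 then x else y"
  have "range ?w \<subseteq> elems M" using assms un_sub by auto
  moreover have "sat M ?w (And (And (Unary 2 0) (Unary 2 1)) (Neg (Equal 0 1)))"
    using ne assms by simp
  ultimately show False using assms(1) unfolding unique_fo_def sat.simps sat_ExAll[OF v] by blast
qed

lemma rule_foD:
  assumes "sat M v (rule_fo P l)" "x \<in> un M (lab_sym l)"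
  obtains h b w where "(h, b) \<in> set (P l)" "range w \<subseteq> elems M" "w 0 = x"
    "sat M w (body_fo (Fact l h # b))"
proof -
  have x: "range (\<lambda>_. x) \<subseteq> elems M" using assms(2) un_sub by auto
  have "sat M (\<lambda>_. x) (Disj (map (\<lambda>(h, b). ExBut0 (body_fo (Fact l h # b))) (P l)))"
  proof (rule ccontr)
    assume "\<not> ?thesis"
    then have "sat M (\<lambda>_. x) (And (Unary (lab_sym l) 0)
        (Neg (Disj (map (\<lambda>(h, b). ExBut0 (body_fo (Fact l h # b))) (P l)))))"
      using assms(2) by simp
    then show False using assms(1) x unfolding rule_fo_def sat.simps(4) sat_ExAll[OF v] by blast
  qed
  then obtain h b where hb: "(h, b) \<in> set (P l)" "sat M (\<lambda>_. x) (ExBut0 (body_fo (Fact l h # b)))"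
    by auto
  then show thesis using that unfolding sat_ExBut0[OF x] by blast
qed

end

lemma sat_index_fo:
  assumes "\<And>x. x \<in> un M 1 \<Longrightarrow> idx x = 0"
  shows "sat M w (index_fo n) \<Longrightarrow> idx (w n) = n"
proof (induction n arbitrary: w)
  case (Suc n)
  then obtain a where a: "(a, w (Suc n)) \<in> rel M Succ" "sat M (w(n := a)) (index_fo n)"
    by auto
  then have "idx a = n" using Suc.IH[OF a(2)] by simp
  then show ?case using Succ_idx a by simp
qed (use assms in simp)

text \<open>The facts read off a word, with named positions replaced by their indices.
  \<open>L\<close> is meant to be the set of labels for which a rule formula is imposed.\<close>

definition facts :: "('l::countable \<Rightarrow> nat) \<Rightarrow> 'l set \<Rightarrow> ('l \<times> nat list) set" where
  "facts ar L = {(l, map idx us) |l us p. l \<in> L \<and> length us = ar l \<and> block M l p us}"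

text \<open>Uniqueness of successors determines every position of the block from its head, and each
  data value names at most one position in symbol 0.\<close>

lemma block_unique:
  assumes num: "\<And>x y. x \<in> un M 0 \<Longrightarrow> y \<in> un M 0 \<Longrightarrow> (x, y) \<in> rel M Sim \<Longrightarrow> x = y"
    and b: "block M l p us" "block M l q ws" and 0: "p 0 = q 0" and len: "length us = length ws"
  shows "us = ws"
proof -
  have pq: "i \<le> length us \<Longrightarrow> p i = q i" for i
  proof (induction i)
    case (Suc i)
    then have "p i = q i" "i < length us" "i < length ws" using len by simp_all
    moreover have "(p i, p (Suc i)) \<in> rel M Succ" "(q i, q (Suc i)) \<in> rel M Succ"
      using b calculation(2,3) by (simp_all add: block_def)
    ultimately show ?case using Succ_unique by simp
  qed (simp add: 0)
  show ?thesis
  proof (rule nth_equalityI[OF len])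
    fix i assume i: "i < length us"
    then have s: "(p (Suc i), us ! i) \<in> rel M Sim" "(q (Suc i), ws ! i) \<in> rel M Sim"
      using b len by (simp_all add: block_def)
    have "p (Suc i) = q (Suc i)" using pq[of "Suc i"] i by simp
    have "(us ! i, ws ! i) \<in> rel M Sim"
      using Sim_equiv s \<open>p (Suc i) = q (Suc i)\<close> unfolding equiv_def by (metis symD transD)
    moreover have "us ! i \<in> un M 0" "ws ! i \<in> un M 0" using b i len by (auto simp: block_def)
    ultimately show "us ! i = ws ! i" by (intro num)
  qed
qed

lemma sat_atom_holds:
  assumes sat: "sat M w (atom_fo j a)" and z: "\<And>x. x \<in> un M 1 \<Longrightarrow> idx x = 0"
    and wf: "\<And>l vs. a = Fact l vs \<Longrightarrow> l \<in> L \<and> length vs = ar l"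
  shows "holds (facts ar L) (\<lambda>v. idx (w (num_var v))) a"
proof (cases a)
  case (Fact l vs)
  have "block M l (\<lambda>i. w (block_var j i)) (map (\<lambda>v. w (num_var v)) vs)"
    using sat unfolding Fact sat_Fact .
  then have "(l, map idx (map (\<lambda>v. w (num_var v)) vs)) \<in> facts ar L"
    unfolding facts_def using wf[OF Fact]
    by (intro CollectI exI[of _ l] exI[of _ "map (\<lambda>v. w (num_var v)) vs"] exI) simp
  then show ?thesis by (simp add: Fact comp_def)
next
  case (IsZero v)
  then show ?thesis using sat z by simp
next
  case (IsSuc v w)
  then show ?thesis using sat Succ_idx by simp
qed

lemma program_fo_sound:
  fixes P :: "'l::countable \<Rightarrow> 'l clause list"
  assumes v: "range v \<subseteq> elems M" and prog: "sat M v (program_fo P ls l0)"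
    and inp: "sat M v (input_fo m)"
    and len: "\<And>l h b. l \<in> set ls \<Longrightarrow> (h, b) \<in> set (P l) \<Longrightarrow> length h = ar l"
    and wf: "\<And>l h b l' vs. l \<in> set ls \<Longrightarrow> (h, b) \<in> set (P l) \<Longrightarrow> Fact l' vs \<in> set b \<Longrightarrow>
      l' \<in> set ls \<and> length vs = ar l'"
    and l0: "l0 \<in> set ls" "ar l0 = 2"
  shows "\<exists>D. supported P UNIV D \<and> (l0, [0, m]) \<in> D"
proof (intro exI conjI)
  let ?D = "facts ar (set ls)"
  have sats: "sat M v first_fo" "sat M v num_fo" "sat M v unique_fo" "sat M v (goal_fo l0)"
    "\<And>l. l \<in> set ls \<Longrightarrow> sat M v (rule_fo P l)"
    using prog by (simp_all add: program_fo_def)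
  note first = first_foD[OF v sats(1)] and num = num_foD[OF v sats(2)]
    and unique = unique_foD[OF v sats(3)]
  show "supported P UNIV ?D"
    unfolding supported_def
  proof (intro allI impI)
    fix l args assume "(l, args) \<in> ?D"
    then obtain us p where us: "args = map idx us" "l \<in> set ls" "length us = ar l" "block M l p us"
      by (auto simp: facts_def)
    then have "p 0 \<in> un M (lab_sym l)" by (simp add: block_def)
    then obtain h b w where w: "(h, b) \<in> set (P l)" "range w \<subseteq> elems M" "w 0 = p 0"
      "sat M w (body_fo (Fact l h # b))"
      by (rule rule_foD[OF v sats(5)[OF us(2)]])
    have head: "sat M w (atom_fo 0 (Fact l h))"
      and body: "\<And>j. j < length b \<Longrightarrow> sat M w (atom_fo (Suc j) (b ! j))"
      using w(4) unfolding sat_body_fo by force+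
    let ?e = "\<lambda>v. idx (w (num_var v))"
    \<comment> \<open>The rule formula yields a block from the same head as the given one; by
      uniqueness the clause instance supports this very fact, not another with the same
      head.\<close>
    have "us = map (\<lambda>v. w (num_var v)) h"
      by (rule block_unique[OF num us(4) head[unfolded sat_Fact]])
        (use w(3) us(3) len[OF us(2) w(1)] in simp_all)
    then have "args = map ?e h" using us(1) by simp
    moreover have "holds ?D ?e a" if "a \<in> set b" for a
    proof -
      from that obtain j where "j < length b" "a = b ! j" by (auto simp: in_set_conv_nth)
      then have sat: "sat M w (atom_fo (Suc j) a)" using body by simp
      show ?thesis
        by (rule sat_atom_holds[OF sat first]) (use wf[OF us(2) w(1)] that in auto)
    qed
    ultimately show "\<exists>h b e. (h, b) \<in> set (P l) \<and> range e \<subseteq> UNIV \<and> args = map e h \<and>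
        (\<forall>a\<in>set b. holds ?D e a)"
      using w(1) by blast
  qed
  obtain w where w: "w (num_var 1) \<in> un M 2" "sat M w (body_fo [Fact l0 [0, 1], IsZero 0])"
    using sats(4) unfolding goal_fo_def sat_ExAll[OF v] by auto
  have fact: "sat M w (atom_fo 0 (Fact l0 [0, 1]))" and z: "sat M w (atom_fo 1 (IsZero 0 :: 'l atom))"
    using w(2) unfolding sat_body_fo by force+
  have "holds ?D (\<lambda>v. idx (w (num_var v))) (Fact l0 [0, 1])"
    by (rule sat_atom_holds[OF fact first]) (use l0 in auto)
  moreover have "idx (w (num_var 0)) = 0" using z first by simp
  moreover have "idx (w (num_var 1)) = m"
  proof -
    obtain a where a: "a \<in> un M 2" "sat M (v(m := a)) (index_fo m)"
      using inp by (auto simp: input_fo_def)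
    \<comment> \<open>Symbol 2 occurs once, so the argument in \<open>goal_fo\<close> is the
      position whose index \<open>input_fo\<close> fixes.\<close>
    have "w (num_var 1) = a" by (rule unique[OF w(1) a(1)])
    then show ?thesis using sat_index_fo[OF first a(2)] by simp
  qed
  ultimately show "(l0, [0, m]) \<in> ?D" by simp
qed

end

section \<open>Indices in finite data words and in \<open>\<omega>\<close>-data-words\<close>

lemma data_word_indexed:
  assumes "data_word \<sigma>0 M"
  shows "\<exists>idx. indexed_word M idx"
proof -
  let ?L = "rel M Less"
  define idx where "idx x = card {y. (y, x) \<in> ?L}" for x
  have s: "is_struct \<sigma>0 M" and fin: "finite (elems M)" and eq: "equiv (elems M) (rel M Sim)"
    and lin: "trans ?L" "irrefl ?L" "total_on (elems M) ?L"
    and S: "rel M Succ = {(a, b) \<in> ?L. \<not> (\<exists>c. (a, c) \<in> ?L \<and> (c, b) \<in> ?L)}"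
    using assms by (auto simp: data_word_def strict_linear_order_on_def)
  note sub = is_struct_subset[OF s]
  have fin': "finite {y. (y, x) \<in> ?L}" for x
    by (rule finite_subset[OF _ fin]) (use sub in blast)
  have tot: "(a, b) \<in> ?L \<or> a = b \<or> (b, a) \<in> ?L" if "a \<in> elems M" "b \<in> elems M" for a b
    using lin(3) that unfolding total_on_def by blast
  have "indexed_word M idx"
  proof
    show "elems M \<noteq> {}" using s by (simp add: is_struct_def)
    show "un M p \<subseteq> elems M" for p by (rule sub)
    show "rel M b \<subseteq> elems M \<times> elems M" for b by (rule sub)
    show "equiv (elems M) (rel M Sim)" by (rule eq)
    show "idx y = Suc (idx x)" if "(x, y) \<in> rel M Succ" for x y
    proof -
      have xy: "(x, y) \<in> ?L" "\<And>c. (x, c) \<in> ?L \<Longrightarrow> (c, y) \<notin> ?L" using that S by auto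
      have "{z. (z, y) \<in> ?L} = insert x {z. (z, x) \<in> ?L}"
      proof (intro equalityI subsetI)
        fix z assume "z \<in> {z. (z, y) \<in> ?L}"
        then have z: "(z, y) \<in> ?L" by simp
        then have "z \<in> elems M" "x \<in> elems M" using sub xy by blast+
        then show "z \<in> insert x {z. (z, x) \<in> ?L}" using tot xy(2) z by blast
      next
        fix z assume "z \<in> insert x {z. (z, x) \<in> ?L}"
        then show "z \<in> {z. (z, y) \<in> ?L}" using xy(1) transD[OF lin(1)] by blast
      qed
      moreover have "x \<notin> {z. (z, x) \<in> ?L}" using lin(2) by (auto simp: irrefl_def)
      ultimately show ?thesis by (simp add: idx_def fin')
    qed
    show "idx x = 0" if x: "x \<in> elems M" and none: "\<And>y. (y, x) \<notin> rel M Succ" for x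
    proof (rule ccontr)
      assume "idx x \<noteq> 0"
      then have ne: "{y. (y, x) \<in> ?L} \<noteq> {}" unfolding idx_def by (metis card.empty)
      let ?S = "{y. (y, x) \<in> ?L}"
      \<comment> \<open>An element below \<open>x\<close> of greatest index is an immediate
        predecessor of \<open>x\<close>: anything strictly between would have a greater
        index.\<close>
      have "Max (idx ` ?S) \<in> idx ` ?S" using ne fin' by (intro Max_in) auto
      then obtain y where y: "(y, x) \<in> ?L" and max_y: "idx y = Max (idx ` ?S)" by auto
      have max: "idx z \<le> idx y" if "(z, x) \<in> ?L" for z
        unfolding max_y using that fin' by (intro Max_ge) auto
      have "(y, c) \<notin> ?L \<or> (c, x) \<notin> ?L" for c
      proof (rule ccontr)
        assume "\<not> ?thesis"
        then have c: "(y, c) \<in> ?L" "(c, x) \<in> ?L" by auto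
        have "y \<notin> {z. (z, y) \<in> ?L}" using lin(2) by (auto simp: irrefl_def)
        then have "{z. (z, y) \<in> ?L} \<subset> {z. (z, c) \<in> ?L}"
          using c(1) transD[OF lin(1)] by blast
        then have "idx y < idx c" unfolding idx_def by (intro psubset_card_mono fin')
        then show False using max[OF c(2)] by simp
      qed
      then show False using none[of y] y S by blast
    qed
    show "y = z" if "(x, y) \<in> rel M Succ" "(x, z) \<in> rel M Succ" for x y z
    proof -
      have "y \<in> elems M" "z \<in> elems M" using that sub by blast+
      moreover have "(y, z) \<notin> ?L" "(z, y) \<notin> ?L" using that unfolding S by auto
      ultimately show ?thesis using tot by blast
    qed
  qed
  then show ?thesis by blast
qed

lemma omega_data_word_indexed:
  assumes "omega_data_word \<sigma>0 M"
  shows "\<exists>idx. indexed_word M idx"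
proof -
  have s: "is_struct \<sigma>0 M" and eq: "equiv (elems M) (rel M Sim)"
    using assms by (simp_all add: omega_data_word_def)
  obtain h :: "nat \<Rightarrow> _" where h: "bij_betw h UNIV (elems M)"
    "\<And>i j. (h i, h j) \<in> rel M Succ \<longleftrightarrow> j = i + 1"
    using assms by (auto simp: omega_data_word_def)
  have inj: "inj h" and surj: "range h = elems M" using h(1) by (auto simp: bij_betw_def)
  note sub = is_struct_subset[OF s]
  have S: "\<exists>i. x = h i \<and> y = h (Suc i)" if "(x, y) \<in> rel M Succ" for x y
  proof -
    have "x \<in> range h" "y \<in> range h" using that sub surj by blast+
    then show ?thesis using that h(2) by auto
  qed
  have "indexed_word M (inv h)"
  proof
    show "elems M \<noteq> {}" using s by (simp add: is_struct_def)
    show "un M p \<subseteq> elems M" for p by (rule sub)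
    show "rel M b \<subseteq> elems M \<times> elems M" for b by (rule sub)
    show "equiv (elems M) (rel M Sim)" by (rule eq)
    show "inv h y = Suc (inv h x)" if "(x, y) \<in> rel M Succ" for x y
      using S[OF that] inj by auto
    show "inv h x = 0" if x: "x \<in> elems M" and none: "\<And>y. (y, x) \<notin> rel M Succ" for x
    proof -
      obtain n where n: "x = h n" using x surj by auto
      have "n = 0" using none[of "h (n - 1)"] h(2)[of "n - 1" n] n by (cases n) auto
      then show ?thesis using n inj by simp
    qed
    show "y = z" if "(x, y) \<in> rel M Succ" "(x, z) \<in> rel M Succ" for x y z
      using S[OF that(1)] S[OF that(2)] inj by (auto dest: injD)
  qed
  then show ?thesis by blast
qed

section \<open>From supported facts to words\<close>

text \<open>A layout of the facts in \<open>D\<close> on the positions \<open>A\<close>: the numbers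
  up to \<open>K\<close> name themselves, and \<open>start d\<close> is the head of the block of
  \<open>d\<close>. Leaving \<open>A\<close> open treats finite and \<open>\<omega>\<close>-words at
  once.\<close>

locale fact_word =
  fixes K m :: nat and D :: "('l::countable \<times> nat list) set"
    and start :: "'l \<times> nat list \<Rightarrow> nat" and datum :: "nat \<Rightarrow> nat" and A :: "nat set"
  assumes datum_num: "i \<le> K \<Longrightarrow> datum i = i"
    and datum_block: "d \<in> D \<Longrightarrow> i < length (snd d) \<Longrightarrow> datum (Suc (start d + i)) = snd d ! i"
    and num_in: "i \<le> K \<Longrightarrow> i \<in> A"
    and block_in: "d \<in> D \<Longrightarrow> i \<le> length (snd d) \<Longrightarrow> start d + i \<in> A"
    and input_le: "m \<le> K"
begin

definition M :: "nat struct" where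
  "M = \<lparr>elems = A,
    un = (\<lambda>p. if p = 0 then {..K} else if p = 1 then {0} else if p = 2 then {m}
      else start ` {d \<in> D. lab_sym (fst d) = p}),
    rel = (\<lambda>b. {(i, j). i \<in> A \<and> j \<in> A \<and>
      (case b of Succ \<Rightarrow> j = Suc i | Less \<Rightarrow> i < j | Sim \<Rightarrow> datum i = datum j)})\<rparr>"

lemma M_simps [simp]:
  "elems M = A"
  "un M 0 = {..K}" "un M (Suc 0) = {0}" "un M 2 = {m}"
  "(i, j) \<in> rel M Succ \<longleftrightarrow> i \<in> A \<and> j \<in> A \<and> j = Suc i"
  "(i, j) \<in> rel M Less \<longleftrightarrow> i \<in> A \<and> j \<in> A \<and> i < j"
  "(i, j) \<in> rel M Sim \<longleftrightarrow> i \<in> A \<and> j \<in> A \<and> datum i = datum j"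
  by (auto simp: M_def)

lemma un_M_lab: "un M (lab_sym l) = start ` {d \<in> D. fst d = l}"
  by (auto simp: M_def lab_sym_def)

lemma equiv_M: "equiv A (rel M Sim)"
  by (rule equivI) (auto simp: M_def intro!: refl_onI symI transI)

lemma body_complete:
  assumes e: "\<And>v. e v \<le> K" and b: "\<And>a. a \<in> set b \<Longrightarrow> holds D e a"
  obtains w where "range w \<subseteq> A" "sat M w (body_fo b)" "\<And>v. w (num_var v) = e v"
    "\<And>l vs b'. b = Fact l vs # b' \<Longrightarrow> w 0 = start (l, map e vs)"
proof -
  define fact where "fact j = (case b ! j of Fact l vs \<Rightarrow> (l, map e vs) | _ \<Rightarrow> undefined)" for j
  \<comment> \<open>Odd variables are the \<open>num_var\<close>s; even ones decode to a pair
    \<open>(j, i)\<close> and go to offset \<open>i\<close> in the block of the \<open>j\<close>-th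
    atom. The default 0 keeps the range inside \<open>A\<close> for variables that address no
    position of the word.\<close>
  define w where "w x = (if odd x then e (x div 2) else
    case prod_decode (x div 2) of (j, i) \<Rightarrow>
      if start (fact j) + i \<in> A then start (fact j) + i else 0)" for x
  have num: "w (num_var v) = e v" for v by (simp add: w_def num_var_def)
  have blk: "w (block_var j i) = start (l, map e vs) + i"
    if "j < length b" "b ! j = Fact l vs" "i \<le> length vs" for j i l vs
  proof -
    have "fact j = (l, map e vs)" using that by (simp add: fact_def)
    moreover have "(l, map e vs) \<in> D" using b[OF nth_mem[OF that(1)]] that(2) by simp
    then have "start (l, map e vs) + i \<in> A" using that by (intro block_in) auto
    ultimately show ?thesis by (simp add: w_def block_var_def)
  qed
  have "range w \<subseteq> A" using e num_in by (auto simp: w_def split: prod.splits)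
  moreover have "sat M w (atom_fo j (b ! j))" if j: "j < length b" for j
  proof (cases "b ! j")
    case (Fact l vs)
    have d: "(l, map e vs) \<in> D" using b[OF nth_mem[OF j]] Fact by simp
    have "block M l (\<lambda>i. w (block_var j i)) (map (\<lambda>v. w (num_var v)) vs)"
      unfolding block_def
    proof (intro conjI allI impI)
      show "w (block_var j 0) \<in> un M (lab_sym l)"
        using blk[OF j Fact, of 0] d by (auto simp: un_M_lab)
      fix i assume "i < length (map (\<lambda>v. w (num_var v)) vs)"
      then have i: "i < length vs" by simp
      have w: "w (block_var j i) = start (l, map e vs) + i"
        "w (block_var j (Suc i)) = Suc (start (l, map e vs) + i)"
        using blk[OF j Fact, of i] blk[OF j Fact, of "Suc i"] i by simp_all
      have A: "start (l, map e vs) + i \<in> A" "Suc (start (l, map e vs) + i) \<in> A"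
        using block_in[OF d, of i] block_in[OF d, of "Suc i"] i by simp_all
      show "(w (block_var j i), w (block_var j (Suc i))) \<in> rel M Succ"
        using A by (simp add: w)
      have "datum (Suc (start (l, map e vs) + i)) = e (vs ! i)"
        using datum_block[OF d, of i] i by simp
      then show "(w (block_var j (Suc i)), map (\<lambda>v. w (num_var v)) vs ! i) \<in> rel M Sim"
        using A i e[of "vs ! i"] by (simp add: w num num_in datum_num)
      show "map (\<lambda>v. w (num_var v)) vs ! i \<in> un M 0" using i e by (simp add: num)
    qed
    then show ?thesis unfolding Fact sat_Fact .
  next
    case (IsZero v)
    then show ?thesis using b[OF nth_mem[OF j]] num_in[of 0] by (simp add: num)
  next
    case (IsSuc v u)
    then have "e u = Suc (e v)" using b[OF nth_mem[OF j]] by simp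
    then show ?thesis using IsSuc num_in[OF e[of v]] num_in[OF e[of u]] by (simp add: num)
  qed
  then have "sat M w (body_fo b)" by (simp add: sat_body_fo)
  moreover have "w 0 = start (l, map e vs)" if "b = Fact l vs # b'" for l vs b'
    using blk[of 0 l vs 0] that by simp
  ultimately show thesis using that num by blast
qed

lemma sat_index_fo_M: "n \<le> K \<Longrightarrow> w n = n \<Longrightarrow> sat M w (index_fo n)"
proof (induction n arbitrary: w)
  case (Suc n)
  have "sat M (w(n := n)) (index_fo n)" using Suc by simp
  then show ?case using Suc.prems num_in[of n] num_in[of "Suc n"] by auto
qed simp

lemma sat_input_fo_M: "sat M w (input_fo m)"
  using sat_index_fo_M[OF input_le, of "w(m := m)"] num_in[OF input_le]
  by (auto simp: input_fo_def)

text \<open>A position with the symbol of a label starts some fact of \<open>D\<close>; the clause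
  instance supporting that fact supplies, through \<open>body_complete\<close>, the witnesses for
  the rule formula.\<close>

lemma program_fo_complete:
  assumes D: "supported P {..K} D" and goal: "(l, [0, m]) \<in> D" and v: "range v \<subseteq> A"
  shows "sat M v (program_fo P ls l)"
proof -
  have v': "range v \<subseteq> elems M" using v by simp
  have "sat M v first_fo"
    unfolding first_fo_def sat.simps sat_ExAll[OF v'] by auto
  moreover have "sat M v num_fo"
    unfolding num_fo_def sat.simps sat_ExAll[OF v'] by (auto simp: datum_num)
  moreover have "sat M v unique_fo"
    unfolding unique_fo_def sat.simps sat_ExAll[OF v'] by auto
  moreover have "sat M v (goal_fo l)"
  proof -
    define e where "e i = (if i = 1 then m else 0)" for i :: nat
    have e: "e i \<le> K" for i using input_le by (simp add: e_def)
    have "holds D e a" if "a \<in> set [Fact l [0, 1], IsZero 0]" for a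
      using that goal by (auto simp: e_def)
    then obtain w where "range w \<subseteq> A" "sat M w (body_fo [Fact l [0, 1], IsZero 0])"
      "\<And>v. w (num_var v) = e v"
      by (rule body_complete[OF e]) blast+
    then show ?thesis unfolding goal_fo_def sat_ExAll[OF v']
      by (intro exI[of _ w]) (simp add: e_def)
  qed
  moreover have "sat M v (rule_fo P l')" for l'
  proof (rule ccontr)
    assume "\<not> sat M v (rule_fo P l')"
    then obtain u where u: "range u \<subseteq> elems M" "u 0 \<in> un M (lab_sym l')"
      and no: "\<not> sat M u (Disj (map (\<lambda>(h, b). ExBut0 (body_fo (Fact l' h # b))) (P l')))"
      unfolding rule_fo_def sat.simps(4) sat_ExAll[OF v'] by auto
    from u(2) obtain args where args: "u 0 = start (l', args)" "(l', args) \<in> D"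
      by (auto simp: un_M_lab)
    obtain h b e where hb: "(h, b) \<in> set (P l')" "range e \<subseteq> {..K}" "args = map e h"
      "\<forall>a\<in>set b. holds D e a"
      by (rule supportedE[OF D args(2)])
    have e: "e i \<le> K" for i using hb(2) by auto
    have "holds D e a" if "a \<in> set (Fact l' h # b)" for a
      using that hb(3,4) args(2) by auto
    then obtain w where "range w \<subseteq> A" "sat M w (body_fo (Fact l' h # b))"
      "w 0 = start (l', map e h)"
      by (rule body_complete[OF e]) blast+
    then have "sat M u (ExBut0 (body_fo (Fact l' h # b)))"
      unfolding sat_ExBut0[OF u(1)] using args hb(3) by auto
    then show False using no hb(1) by auto
  qed
  ultimately show ?thesis by (simp add: program_fo_def)
qed

lemma is_struct_M:
  assumes "finite \<sigma>" "{0, 1, 2} \<union> (\<lambda>d. lab_sym (fst d)) ` D \<subseteq> \<sigma>"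
  shows "is_struct \<sigma> M"
proof -
  have "un M p \<subseteq> A" for p
    using num_in input_le block_in[of _ 0] by (auto simp: M_def)
  moreover have "un M p = {}" if "p \<notin> \<sigma>" for p
    using that assms(2) by (auto simp: M_def)
  moreover have "rel M b \<subseteq> A \<times> A" for b by (auto simp: M_def)
  moreover have "A \<noteq> {}" using num_in[of 0] by auto
  ultimately show ?thesis using assms(1) by (simp add: is_struct_def)
qed

lemma data_word_M:
  assumes "is_struct \<sigma> M" and A: "A = {..T}"
  shows "data_word \<sigma> M"
proof -
  have "strict_linear_order_on A (rel M Less)"
    unfolding strict_linear_order_on_def
    by (auto simp: irrefl_def total_on_def intro!: transI)
  moreover have "rel M Succ = {(a, b) \<in> rel M Less. \<not> (\<exists>c. (a, c) \<in> rel M Less \<and> (c, b) \<in> rel M Less)}"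
  proof -
    have "j = Suc i \<longleftrightarrow> i < j \<and> \<not> (\<exists>c. c \<in> A \<and> i < c \<and> c < j)" if "j \<in> A" for i j
    proof
      assume "i < j \<and> \<not> (\<exists>c. c \<in> A \<and> i < c \<and> c < j)"
      \<comment> \<open>\<open>A\<close> is an initial segment, so \<open>Suc i\<close> belongs to
        \<open>A\<close> and would lie strictly between if \<open>Suc i < j\<close>.\<close>
      then show "j = Suc i" using that A by (metis Suc_lessI atMost_iff le_trans lessI less_imp_le)
    qed auto
    then show ?thesis
      by (simp only: set_eq_iff split_paired_All mem_Collect_eq prod.case M_simps) blast
  qed
  moreover have "finite A" using A by simp
  ultimately show ?thesis
    unfolding data_word_def M_simps by (intro conjI assms(1) equiv_M)
qed

lemma omega_data_word_M:
  assumes "is_struct \<sigma> M" and A: "A = UNIV"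
  shows "omega_data_word \<sigma> M"
proof -
  have "bij_betw id UNIV A" "\<And>i. i \<in> A" using A by simp_all
  then show ?thesis
    unfolding omega_data_word_def
    by (intro conjI exI[of _ id] assms(1)) (simp_all add: equiv_M)
qed

end

text \<open>After the numbers come slots of a common width \<open>W\<close>, greater than every
  argument length. The block of \<open>d\<close> fills the slot numbered \<open>to_nat d\<close>, so
  division by \<open>W\<close> recovers the fact and the remainder the offset. Offset 0 is the head,
  hence the shift by one in \<open>datum\<close>.\<close>

lemma ex_fact_word:
  fixes D :: "('l::countable \<times> nat list) set"
  assumes "finite D" "m \<le> K"
  obtains start datum T where "fact_word K m D start datum {..T}" "fact_word K m D start datum UNIV"
proof -
  define W where "W = Suc (Max (insert 0 ((\<lambda>d. length (snd d)) ` D)))"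
  have W: "length (snd d) < W" if "d \<in> D" for d
    unfolding W_def using that assms(1) by (simp add: less_Suc_eq_le)
  define start :: "'l \<times> nat list \<Rightarrow> nat" where "start d = Suc K + W * to_nat d" for d
  define datum where "datum i = (if i \<le> K then i else
    snd (from_nat ((i - Suc K) div W) :: 'l \<times> nat list) ! ((i - Suc K) mod W - 1))" for i
  define T where "T = Max (insert K ((\<lambda>d. start d + W) ` D))"
  have blk: "datum (Suc (start d + i)) = snd d ! i" if "d \<in> D" "i < length (snd d)" for d i
  proof -
    have i: "Suc i < W" using W[OF that(1)] that(2) by simp
    have "Suc (start d + i) - Suc K = Suc i + W * to_nat d" by (simp add: start_def)
    moreover have "(Suc i + W * to_nat d) div W = to_nat d" "(Suc i + W * to_nat d) mod W = Suc i"
      using i by (simp_all only: div_mult_self2 mod_mult_self2 div_less mod_less)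
    moreover have "\<not> Suc (start d + i) \<le> K" by (simp add: start_def)
    ultimately show ?thesis by (simp add: datum_def)
  qed
  have "i \<le> T" if "i \<le> K" for i
    unfolding T_def using that assms(1) by (simp add: Max_ge_iff)
  moreover have "start d + i \<le> T" if "d \<in> D" "i \<le> length (snd d)" for d i
  proof -
    have "start d + W \<le> T" unfolding T_def using that(1) assms(1) by (intro Max_ge) auto
    then show ?thesis using W[OF that(1)] that(2) by simp
  qed
  ultimately show thesis
    using assms(2) blk
    by (intro that[of start datum T]; unfold_locales) (auto simp: datum_def)
qed

section \<open>Sentences for evaluation to 0\<close>

text \<open>\<open>SOME\<close> may fix the order of the rules: the diagonal argument uses this
  formula for one fixed \<open>q\<close>, with its code given as the input, and never computes it
  from \<open>q\<close>.\<close>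

definition halting_fo :: "recf \<Rightarrow> fo" where
  "halting_fo q = program_fo prog (SOME ls. set ls = labs q 1) (Eval q 1)"

lemma halting_fo_sound:
  assumes M: "indexed_word M idx" and sat: "models M (And (halting_fo q) (input_fo m))"
  shows "evaluates q [m] 0"
proof -
  interpret indexed_word M idx by (rule M)
  let ?ls = "SOME ls. set ls = labs q 1"
  have ls: "set ?ls = labs q 1"
    by (rule someI_ex) (rule finite_list[OF finite_labs])
  obtain a where "a \<in> elems M" using nonempty by blast
  then have v: "range (\<lambda>_. a) \<subseteq> elems M" by auto
  have "sat M (\<lambda>_. a) (program_fo prog ?ls (Eval q 1))" "sat M (\<lambda>_. a) (input_fo m)"
    using sat v by (auto simp: models_def halting_fo_def)
  from program_fo_sound[OF v this, of arity]
  obtain D where "supported prog UNIV D" "(Eval q 1, [0, m]) \<in> D"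
    using length_head length_Fact labs_closed Eval_labs unfolding ls by auto
  then show ?thesis by (rule prog_sound)
qed

lemma halting_fo_complete:
  assumes "evaluates q [m] 0"
  shows "fin_satisfiable (And (halting_fo q) (input_fo m))"
    "omega_satisfiable (And (halting_fo q) (input_fo m))"
proof -
  let ?\<phi> = "And (halting_fo q) (input_fo m)"
  obtain K D where D: "finite D" "supported prog {..K} D" "(Eval q 1, [0, m]) \<in> D"
    using prog_complete[OF assms] by (auto simp: derivable_def)
  \<comment> \<open>\<open>m\<close> is the value of a head variable in the clause instance that
    supports the goal fact.\<close>
  have "m \<le> K" by (rule supportedE[OF D(2,3)]) auto
  then obtain start datum T where words: "fact_word K m D start datum {..T}"
    "fact_word K m D start datum UNIV"
    by (rule ex_fact_word[OF D(1)])
  \<comment> \<open>\<open>D\<close> may contain facts whose labels do not occur in the formula, so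
    their symbols are added.\<close>
  define \<sigma> where "\<sigma> = unary_syms ?\<phi> \<union> ({0, 1, 2} \<union> (\<lambda>d. lab_sym (fst d)) ` D)"
  have \<sigma>: "finite \<sigma>" "{0, 1, 2} \<union> (\<lambda>d. lab_sym (fst d)) ` D \<subseteq> \<sigma>" "unary_syms ?\<phi> \<subseteq> \<sigma>"
    using D(1) finite_unary_syms[of ?\<phi>] by (auto simp: \<sigma>_def)
  show "fin_satisfiable ?\<phi>"
  proof -
    interpret fact_word K m D start datum "{..T}" by (rule words)
    have "models M ?\<phi>"
      using program_fo_complete[OF D(2,3)] sat_input_fo_M by (simp add: models_def halting_fo_def)
    then show ?thesis
      using fin_satisfiableI[OF \<sigma>(3) data_word_M[OF is_struct_M[OF \<sigma>(1,2)] refl]] by blast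
  qed
  show "omega_satisfiable ?\<phi>"
  proof -
    interpret fact_word K m D start datum UNIV by (rule words)
    have "models M ?\<phi>"
      using program_fo_complete[OF D(2,3)] sat_input_fo_M by (simp add: models_def halting_fo_def)
    then show ?thesis
      using omega_satisfiableI[OF \<sigma>(3) omega_data_word_M[OF is_struct_M[OF \<sigma>(1,2)] refl]] by blast
  qed
qed

lemma fin_satisfiable_halting_fo:
  "fin_satisfiable (And (halting_fo q) (input_fo m)) \<longleftrightarrow> evaluates q [m] 0"
proof
  assume "fin_satisfiable (And (halting_fo q) (input_fo m))"
  then obtain \<sigma> and M :: "nat struct" where "data_word \<sigma> M" "models M (And (halting_fo q) (input_fo m))"
    by (auto simp: fin_satisfiable_def)
  then show "evaluates q [m] 0" using data_word_indexed halting_fo_sound by blast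
qed (rule halting_fo_complete)

lemma omega_satisfiable_halting_fo:
  "omega_satisfiable (And (halting_fo q) (input_fo m)) \<longleftrightarrow> evaluates q [m] 0"
proof
  assume "omega_satisfiable (And (halting_fo q) (input_fo m))"
  then obtain \<sigma> and M :: "nat struct" where "omega_data_word \<sigma> M" "models M (And (halting_fo q) (input_fo m))"
    by (auto simp: omega_satisfiable_def)
  then show "evaluates q [m] 0" using omega_data_word_indexed halting_fo_sound by blast
qed (rule halting_fo_complete)

lemma halting_fo_sentence: "And (halting_fo q) (input_fo m) \<in> sentences (F1 {Succ, Sim})"
  by (simp add: sentences_def halting_fo_def And_F1 program_fo_F1 input_fo_F1 fv_program_fo)


section \<open>Diagonalization\<close>

lemma evaluates_Comp1: "evaluates g xs y \<Longrightarrow> evaluates f [y] z \<Longrightarrow> evaluates (Comp f [g]) xs z"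
  by (rule evaluates.intros(4)[where ys = "[y]"]) auto

lemma evaluates_Comp2:
  "evaluates g xs y \<Longrightarrow> evaluates h xs z \<Longrightarrow> evaluates f [y, z] u \<Longrightarrow> evaluates (Comp f [g, h]) xs u"
  by (rule evaluates.intros(4)[where ys = "[y, z]"]) auto

lemma evaluates_Proj: "i < length xs \<Longrightarrow> xs ! i = y \<Longrightarrow> evaluates (Proj i) xs y"
  using evaluates.intros(3) by blast

section \<open>Recursive functions computing the codes of \<open>And\<close> and
  \<open>input_fo\<close>\<close>

primrec const_rec :: "nat \<Rightarrow> recf" where
  "const_rec 0 = Zero"
| "const_rec (Suc n) = Comp Succr [const_rec n]"

definition add_rec :: recf where
  "add_rec = PrimRec (Proj 0) (Comp Succr [Proj 1])"

definition triangle_rec :: recf where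
  "triangle_rec = PrimRec Zero (Comp Succr [Comp add_rec [Proj 0, Proj 1]])"

text \<open>Cantor pairing of the two values, \<open>triangle (m + n) + m\<close>, which is
  \<open>prod_encode\<close>.\<close>

definition pair_rec :: "recf \<Rightarrow> recf \<Rightarrow> recf" where
  "pair_rec f g = Comp (Comp add_rec [Comp triangle_rec [add_rec], Proj 0]) [f, g]"

text \<open>The constants 3 and 4 are the tags of \<open>Neg\<close> and \<open>Or\<close> in
  \<open>fo_code\<close>.\<close>

definition and_rec :: "recf \<Rightarrow> recf \<Rightarrow> recf" where
  "and_rec f g = pair_rec (const_rec 3) (pair_rec (const_rec 4)
     (pair_rec (pair_rec (const_rec 3) f) (pair_rec (const_rec 3) g)))"

text \<open>In the step, \<open>Proj 0\<close> is \<open>n\<close> and \<open>Proj 1\<close> the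
  code of \<open>index_fo n\<close>; the constants 5, 1 and 0 are the tags of \<open>Exists\<close>,
  \<open>Binary\<close> and \<open>Succ\<close>.\<close>

definition index_rec :: recf where
  "index_rec = PrimRec (const_rec (fo_code (index_fo 0)))
     (pair_rec (const_rec 5) (pair_rec (Proj 0) (and_rec
        (pair_rec (const_rec 1) (pair_rec (const_rec 0) (pair_rec (Proj 0) (Comp Succr [Proj 0]))))
        (Proj 1))))"

definition input_rec :: recf where
  "input_rec = pair_rec (const_rec 5) (pair_rec (Proj 0) (and_rec
     (pair_rec (const_rec 0) (pair_rec (const_rec 2) (Proj 0))) index_rec))"

lemma evaluates_const_rec: "evaluates (const_rec n) xs n"
  by (induction n) (auto intro: evaluates.intros evaluates_Comp1)

lemma evaluates_add_rec: "evaluates add_rec [m, n] (m + n)"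
proof (induction m)
  case 0
  show ?case unfolding add_rec_def by (auto intro!: evaluates.intros evaluates_Proj)
next
  case (Suc m)
  have "evaluates (Comp Succr [Proj 1]) [m, m + n, n] (Suc m + n)"
    by (rule evaluates_Comp1[OF evaluates_Proj]) (auto intro: evaluates.intros)
  with Suc show ?case unfolding add_rec_def by (rule evaluates.intros)
qed

lemma evaluates_triangle_rec: "evaluates triangle_rec [n] (triangle n)"
proof (induction n)
  case 0
  show ?case unfolding triangle_rec_def by (auto intro!: evaluates.intros)
next
  case (Suc n)
  have "evaluates (Comp add_rec [Proj 0, Proj 1]) [n, triangle n] (n + triangle n)"
    by (rule evaluates_Comp2[OF evaluates_Proj evaluates_Proj evaluates_add_rec]) auto
  then have "evaluates (Comp Succr [Comp add_rec [Proj 0, Proj 1]]) [n, triangle n] (triangle (Suc n))"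
    by (rule evaluates_Comp1) (auto intro: evaluates.intros simp: add.commute)
  with Suc show ?case unfolding triangle_rec_def by (rule evaluates.intros)
qed

lemma evaluates_pair_rec:
  assumes "evaluates f xs m" "evaluates g xs n"
  shows "evaluates (pair_rec f g) xs (prod_encode (m, n))"
proof -
  have "evaluates (Comp triangle_rec [add_rec]) [m, n] (triangle (m + n))"
    by (rule evaluates_Comp1[OF evaluates_add_rec evaluates_triangle_rec])
  then have "evaluates (Comp add_rec [Comp triangle_rec [add_rec], Proj 0]) [m, n] (triangle (m + n) + m)"
    by (rule evaluates_Comp2[OF _ evaluates_Proj evaluates_add_rec]) auto
  then show ?thesis unfolding pair_rec_def prod_encode_def
    by (simp add: evaluates_Comp2[OF assms])
qed

lemma evaluates_and_rec:
  assumes "evaluates f xs (fo_code \<phi>)" "evaluates g xs (fo_code \<psi>)"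
  shows "evaluates (and_rec f g) xs (fo_code (And \<phi> \<psi>))"
  unfolding and_rec_def And_def fo_code.simps
  by (intro evaluates_pair_rec evaluates_const_rec assms)

lemma evaluates_index_rec: "evaluates index_rec [n] (fo_code (index_fo n))"
proof (induction n)
  case 0
  show ?case unfolding index_rec_def by (intro evaluates.intros evaluates_const_rec)
next
  case (Suc n)
  let ?xs = "[n, fo_code (index_fo n)]"
  have "evaluates (Comp Succr [Proj 0]) ?xs (Suc n)"
    by (rule evaluates_Comp1[OF evaluates_Proj]) (auto intro: evaluates.intros)
  then have "evaluates (pair_rec (const_rec 1) (pair_rec (const_rec 0)
      (pair_rec (Proj 0) (Comp Succr [Proj 0])))) ?xs (fo_code (Binary Succ n (Suc n)))"
    unfolding fo_code.simps binsym_code.simps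
    by (intro evaluates_pair_rec evaluates_const_rec evaluates_Proj) auto
  then have "evaluates (pair_rec (const_rec 5) (pair_rec (Proj 0) (and_rec
        (pair_rec (const_rec 1) (pair_rec (const_rec 0) (pair_rec (Proj 0) (Comp Succr [Proj 0]))))
        (Proj 1)))) ?xs (fo_code (index_fo (Suc n)))"
    unfolding index_fo.simps fo_code.simps(6)
    by (intro evaluates_pair_rec evaluates_and_rec evaluates_const_rec) (auto intro: evaluates_Proj)
  with Suc show ?case unfolding index_rec_def by (rule evaluates.intros)
qed

lemma evaluates_input_rec: "evaluates input_rec [n] (fo_code (input_fo n))"
proof -
  have "evaluates (pair_rec (const_rec 0) (pair_rec (const_rec 2) (Proj 0))) [n] (fo_code (Unary 2 n))"
    unfolding fo_code.simps
    by (intro evaluates_pair_rec evaluates_const_rec evaluates_Proj) auto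
  then show ?thesis
    unfolding input_rec_def input_fo_def fo_code.simps(6)
    by (intro evaluates_pair_rec evaluates_and_rec evaluates_const_rec evaluates_index_rec)
      (auto intro: evaluates_Proj)
qed

text \<open>
  With \<open>p\<close> a decision procedure, let \<open>q\<close> map the code \<open>m\<close> of a formula \<open>\<psi>\<close> to the verdict of
  \<open>p\<close> on \<open>\<psi>\<close> conjoined with ``the input is \<open>m\<close>''. For \<open>\<psi> = halting_fo q\<close> that sentence
  asserts its own unsatisfiability.
\<close>

lemma undecidable:
  assumes S: "\<And>q m. S (And (halting_fo q) (input_fo m)) \<longleftrightarrow> evaluates q [m] 0"
  shows "\<not> decidable fo_code (sentences (F1 {Succ, Sim})) S"
proof
  assume "decidable fo_code (sentences (F1 {Succ, Sim})) S"
  then obtain p where p: "\<And>\<phi>. \<phi> \<in> sentences (F1 {Succ, Sim}) \<Longrightarrow>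
      evaluates p [fo_code \<phi>] (if S \<phi> then 1 else 0)"
    unfolding decidable_def by blast
  define q where "q = Comp p [and_rec (Proj 0) input_rec]"
  define m where "m = fo_code (halting_fo q)"
  define \<phi> where "\<phi> = And (halting_fo q) (input_fo m)"
  have "evaluates (and_rec (Proj 0) input_rec) [m] (fo_code \<phi>)"
    unfolding \<phi>_def
    by (rule evaluates_and_rec[OF evaluates_Proj evaluates_input_rec]) (simp_all add: m_def)
  moreover have "evaluates p [fo_code \<phi>] (if S \<phi> then 1 else 0)"
    by (rule p) (simp add: \<phi>_def halting_fo_sentence)
  ultimately have eval: "evaluates q [m] (if S \<phi> then 1 else 0)"
    unfolding q_def by (rule evaluates_Comp1)
  show False
  proof (cases "S \<phi>")
    case True
    then have "evaluates q [m] 0" using S by (simp add: \<phi>_def)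
    then show False using evaluates_deterministic[OF eval] True by fastforce
  next
    case False
    then have "evaluates q [m] 0" using eval by simp
    then show False using S False by (simp add: \<phi>_def)
  qed
qed

theorem theorem4p9:
  "\<not> decidable fo_code (sentences (F1 {Succ, Sim})) fin_satisfiable
   \<and> \<not> decidable fo_code (sentences (F1 {Succ, Sim})) omega_satisfiable"
  by (intro conjI undecidable fin_satisfiable_halting_fo omega_satisfiable_halting_fo)

end
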